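(* For any isoparametric hypersurface $M^n\subset S^{n+1}(1)$, the scalar curvature of $M^n$ satisfies $R_M\geq 0$.
   Context: $S^{n+1}(1)$ is the unit sphere with its standard metric. A hypersurface of the sphere is called isoparametric if its principal curvature functions (the eigenvalues of the shape operator with respect to a unit normal field) are constant. $R_M$ denotes the scalar curvature of $M^n$ with the induced metric (for the standard unit $n$-sphere it equals $n(n-1)$). *)

theory Defs
  imports "HOL-Analysis.Analysis" "HOL-Library.Multiset"
begin

section \<open>Smooth maps and hypersurfaces of the unit sphere\<close>

primrec Ck_on :: "nat \<Rightarrow> ('a::real_normed_vector \<Rightarrow> 'b::real_normed_vector) \<Rightarrow> 'a set \<Rightarrow> bool" where
  "Ck_on 0 f U \<longleftrightarrow> continuous_on U f"
| "Ck_on (Suc k) f U \<longleftrightarrow>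
     (\<forall>x\<in>U. f differentiable at x) \<and> (\<forall>v. Ck_on k (\<lambda>x. frechet_derivative f (at x) v) U)"

text \<open>Meant for open sets \<open>U\<close> in finite-dimensional spaces.\<close>

definition smooth_on :: "('a::euclidean_space \<Rightarrow> 'b::euclidean_space) \<Rightarrow> 'a set \<Rightarrow> bool" where
  "smooth_on f U \<longleftrightarrow> (\<forall>k. Ck_on k f U)"

text \<open>
  A local parametrization of \<open>M\<close>: the inverse of a chart. It is a smooth immersion of an open
  set of \<open>\<real>\<^sup>n\<close> and a homeomorphism onto a relatively open subset of \<open>M\<close>.
\<close>

definition local_parametrization ::
    "'a::euclidean_space set \<Rightarrow> (real^'n::finite) set \<Rightarrow> (real^'n \<Rightarrow> 'a) \<Rightarrow> bool" where
  "local_parametrization M U \<phi> \<longleftrightarrow>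
     open U \<and> smooth_on \<phi> U \<and>
     (\<forall>u\<in>U. inj (frechet_derivative \<phi> (at u))) \<and>
     openin (top_of_set M) (\<phi> ` U) \<and>
     (\<exists>\<psi>. homeomorphism U (\<phi> ` U) \<phi> \<psi>)"

text \<open>
  The dimension \<open>n\<close> of the hypersurface is \<open>CARD('n)\<close>, and the ambient Euclidean space of the
  sphere has dimension \<open>n + 2\<close>. The hypersurface need not be closed or connected.
\<close>

definition sphere_hypersurface :: "'n::finite itself \<Rightarrow> 'a::euclidean_space set \<Rightarrow> bool" where
  "sphere_hypersurface T M \<longleftrightarrow>
     DIM('a) = CARD('n) + 2 \<and> M \<subseteq> sphere 0 1 \<and>
     (\<forall>p\<in>M. \<exists>U (\<phi> :: real^'n \<Rightarrow> 'a). local_parametrization M U \<phi> \<and> p \<in> \<phi> ` U)"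

definition tangent_space :: "'a::euclidean_space set \<Rightarrow> 'a \<Rightarrow> 'a set" where
  "tangent_space M p =
     {v. \<exists>\<gamma> :: real \<Rightarrow> 'a. \<exists>\<epsilon>>0. \<gamma> ` {-\<epsilon><..<\<epsilon>} \<subseteq> M \<and> \<gamma> 0 = p \<and>
           (\<gamma> has_vector_derivative v) (at 0)}"


section \<open>Shape operator and principal curvatures\<close>

text \<open>The normal is tangent to the sphere, hence orthogonal to the position vector.\<close>

definition unit_normal_field ::
    "'n::finite itself \<Rightarrow> 'a::euclidean_space set \<Rightarrow> ('a \<Rightarrow> 'a) \<Rightarrow> bool" where
  "unit_normal_field T M \<nu> \<longleftrightarrow>
     (\<forall>U (\<phi> :: real^'n \<Rightarrow> 'a). local_parametrization M U \<phi> \<longrightarrow> smooth_on (\<nu> \<circ> \<phi>) U) \<and>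
     (\<forall>p\<in>M. norm (\<nu> p) = 1 \<and> \<nu> p \<bullet> p = 0 \<and> (\<forall>v\<in>tangent_space M p. \<nu> p \<bullet> v = 0))"

text \<open>
  The Weingarten map, meant for \<open>v \<in> tangent_space M p\<close>: there (and only there) the derivative
  of \<open>\<nu>\<close> within \<open>M\<close> is uniquely determined. The sphere's covariant derivative of \<open>\<nu>\<close> along \<open>v\<close>
  is the tangential part of the Euclidean one; they agree since differentiating \<open>\<nu> p \<bullet> p = 0\<close>
  shows that the Euclidean derivative is orthogonal to \<open>p\<close>.
\<close>

definition shape_operator :: "'a::euclidean_space set \<Rightarrow> ('a \<Rightarrow> 'a) \<Rightarrow> 'a \<Rightarrow> 'a \<Rightarrow> 'a" where
  "shape_operator M \<nu> p v = - frechet_derivative \<nu> (at p within M) v"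

definition shape_eigenspace ::
    "'a::euclidean_space set \<Rightarrow> ('a \<Rightarrow> 'a) \<Rightarrow> 'a \<Rightarrow> real \<Rightarrow> 'a set" where
  "shape_eigenspace M \<nu> p \<kappa> = {v \<in> tangent_space M p. shape_operator M \<nu> p v = \<kappa> *\<^sub>R v}"

text \<open>
  The principal curvatures counted with multiplicity. There are exactly \<open>n\<close> of them, as the shape
  operator is self-adjoint on the \<open>n\<close>-dimensional tangent space.
\<close>

definition principal_curvatures ::
    "'a::euclidean_space set \<Rightarrow> ('a \<Rightarrow> 'a) \<Rightarrow> 'a \<Rightarrow> real multiset" where
  "principal_curvatures M \<nu> p =
     (\<Sum>\<kappa> \<in> {\<kappa>. \<exists>v\<in>shape_eigenspace M \<nu> p \<kappa>. v \<noteq> 0}.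
        replicate_mset (dim (shape_eigenspace M \<nu> p \<kappa>)) \<kappa>)"

text \<open>
  The principal curvature functions in nondecreasing order, indexed by \<open>i < n\<close>.
\<close>

definition principal_curvature ::
    "'a::euclidean_space set \<Rightarrow> ('a \<Rightarrow> 'a) \<Rightarrow> nat \<Rightarrow> 'a \<Rightarrow> real" where
  "principal_curvature M \<nu> i p = sorted_list_of_multiset (principal_curvatures M \<nu> p) ! i"

definition isoparametric_hypersurface ::
    "'n::finite itself \<Rightarrow> 'a::euclidean_space set \<Rightarrow> bool" where
  "isoparametric_hypersurface T M \<longleftrightarrow>
     sphere_hypersurface T M \<and>
     (\<exists>\<nu>. unit_normal_field T M \<nu> \<and> (\<forall>i<CARD('n). principal_curvature M \<nu> i constant_on M))"


section \<open>Scalar curvature of a Riemannian metric in local coordinates\<close>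

definition pderiv_at :: "'n::finite \<Rightarrow> (real^'n \<Rightarrow> real) \<Rightarrow> real^'n \<Rightarrow> real" where
  "pderiv_at i h u = frechet_derivative h (at u) (axis i 1)"

definition induced_metric ::
    "(real^'n::finite \<Rightarrow> 'a::euclidean_space) \<Rightarrow> real^'n \<Rightarrow> real^'n^'n" where
  "induced_metric \<phi> u =
     (\<chi> i j. frechet_derivative \<phi> (at u) (axis i 1) \<bullet> frechet_derivative \<phi> (at u) (axis j 1))"

text \<open>\<open>christoffel g k i j\<close> is \<open>\<Gamma>\<^sup>k\<^sub>i\<^sub>j\<close>.\<close>

definition christoffel ::
    "(real^'n::finite \<Rightarrow> real^'n^'n) \<Rightarrow> 'n \<Rightarrow> 'n \<Rightarrow> 'n \<Rightarrow> real^'n \<Rightarrow> real" where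
  "christoffel g k i j u =
     1/2 * (\<Sum>l\<in>UNIV. matrix_inv (g u) $ k $ l *
       (pderiv_at i (\<lambda>w. g w $ j $ l) u + pderiv_at j (\<lambda>w. g w $ i $ l) u
        - pderiv_at l (\<lambda>w. g w $ i $ j) u))"

text \<open>
  \<open>riemann g l k i j\<close> is the coefficient of \<open>\<partial>\<^sub>l\<close> in \<open>R(\<partial>\<^sub>i, \<partial>\<^sub>j) \<partial>\<^sub>k\<close>, where
  \<open>R(X, Y) = \<nabla>\<^sub>X \<nabla>\<^sub>Y - \<nabla>\<^sub>Y \<nabla>\<^sub>X - \<nabla>\<^sub>[\<^sub>X\<^sub>,\<^sub>Y\<^sub>]\<close>. The Ricci form is
  \<open>Ric(Y, Z) = tr (X \<mapsto> R(X, Y) Z)\<close>; with these signs the scalar curvature of the unit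
  \<open>n\<close>-sphere is \<open>n(n - 1)\<close>.
\<close>

definition riemann ::
    "(real^'n::finite \<Rightarrow> real^'n^'n) \<Rightarrow> 'n \<Rightarrow> 'n \<Rightarrow> 'n \<Rightarrow> 'n \<Rightarrow> real^'n \<Rightarrow> real" where
  "riemann g l k i j u =
     pderiv_at i (christoffel g l j k) u - pderiv_at j (christoffel g l i k) u
     + (\<Sum>m\<in>UNIV. christoffel g l i m u * christoffel g m j k u
                 - christoffel g l j m u * christoffel g m i k u)"

definition ricci ::
    "(real^'n::finite \<Rightarrow> real^'n^'n) \<Rightarrow> 'n \<Rightarrow> 'n \<Rightarrow> real^'n \<Rightarrow> real" where
  "ricci g j k u = (\<Sum>i\<in>UNIV. riemann g i k i j u)"

definition scalar_curvature :: "(real^'n::finite \<Rightarrow> real^'n^'n) \<Rightarrow> real^'n \<Rightarrow> real" where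
  "scalar_curvature g u = (\<Sum>j\<in>UNIV. \<Sum>k\<in>UNIV. matrix_inv (g u) $ j $ k * ricci g j k u)"

end

theory Submission
  imports Defs
begin

text \<open>
  Fix a point of the hypersurface and an orthonormal basis \<open>B\<close> of its tangent space consisting of
  eigenvectors of the shape operator, with eigenvalues \<open>\<lambda>\<^sub>a\<close>. By the Gauss equation the scalar
  curvature is the sum of \<open>1 + \<lambda>\<^sub>a \<lambda>\<^sub>b\<close> over all ordered pairs \<open>a \<noteq> b\<close> in \<open>B\<close>
  (\<open>scalar_curvature_eq_eigenvalues\<close>). A pair with equal eigenvalues contributes
  \<open>1 + \<lambda>\<^sub>a\<^sup>2 > 0\<close>. The pairs with distinct eigenvalues contribute zero altogether, which is a weighted
  sum of Cartan's identities for the principal curvatures of an isoparametric hypersurface.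

  The reason for the last claim is the formula
  \<open>1 + \<lambda>\<^sub>a \<lambda>\<^sub>b = 2 \<Sum>\<^sub>c h\<^sub>a\<^sub>b\<^sub>c\<^sup>2 / ((\<lambda>\<^sub>a - \<lambda>\<^sub>c) (\<lambda>\<^sub>b - \<lambda>\<^sub>c))\<close> for \<open>\<lambda>\<^sub>a \<noteq> \<lambda>\<^sub>b\<close>
  (\<open>sectional_curvature_eq\<close>), where \<open>h\<close> is the covariant derivative of the second fundamental form.
  By Codazzi \<open>h\<close> is totally symmetric, and as the principal curvatures are constant it vanishes when
  two of its indices belong to the same eigenvalue. So, summing over all \<open>a\<close>, \<open>b\<close> and \<open>c\<close>,
  one may average over cyclic permutations of the indices, and
  \<open>1/((x - z) (y - z)) + 1/((y - x) (z - x)) + 1/((z - y) (x - y)) = 0\<close>.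

  To obtain the formula, the second derivative of the shape operator is computed twice.
  Second order perturbation theory of a constant eigenvalue expresses its diagonal entries by
  \<open>h\<close> (\<open>second_variation\<close>), while commuting partial derivatives of the Codazzi equation compare
  the entry \<open>a\<close> in the direction \<open>b\<close> with the entry \<open>b\<close> in the direction \<open>a\<close>; the
  difference is \<open>(\<lambda>\<^sub>a - \<lambda>\<^sub>b) (1 + \<lambda>\<^sub>a \<lambda>\<^sub>b)\<close> (\<open>second_variation_difference\<close>).

  All of this takes place in the ambient Euclidean space. The shape operator is extended by zero on the
  plane spanned by the position vector and the normal, so that along a parametrization it
  is an operator-valued function \<open>T\<close> on an open set of \<open>\<real>\<^sup>n\<close>, to which
  flat partial derivatives apply; Christoffel symbols are needed only for the Gauss equation.
\<close>

section \<open>Directional derivatives of smooth maps\<close>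

definition dir_deriv :: "'a::real_normed_vector \<Rightarrow> ('a \<Rightarrow> 'b::real_normed_vector) \<Rightarrow> 'a \<Rightarrow> 'b"
    ("\<partial>\<^bsub>_\<^esub>") where
  "\<partial>\<^bsub>w\<^esub> f = (\<lambda>x. frechet_derivative f (at x) w)"

text \<open>
  The predicate \<open>smooth_on\<close> is restricted to Euclidean codomains; the extended shape operator takes values
  in a space of bounded linear operators.
\<close>
definition smooth_map :: "'a::real_normed_vector set \<Rightarrow> ('a \<Rightarrow> 'b::real_normed_vector) \<Rightarrow> bool" where
  "smooth_map U f \<longleftrightarrow> (\<forall>k. Ck_on k f U)"

lemma smooth_on_eq_smooth_map: "smooth_on f U = smooth_map U f"
  by (simp add: smooth_on_def smooth_map_def)

lemma dir_deriv_eqI: "(f has_derivative f') (at x) \<Longrightarrow> \<partial>\<^bsub>w\<^esub> f x = f' w"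
  by (simp add: dir_deriv_def flip: frechet_derivative_at)

lemma has_derivative_dir_deriv:
  "f differentiable at x \<Longrightarrow> (f has_derivative (\<lambda>w. \<partial>\<^bsub>w\<^esub> f x)) (at x)"
  by (simp add: dir_deriv_def frechet_derivative_works)

lemma linear_dir_deriv: "f differentiable at x \<Longrightarrow> linear (\<lambda>w. \<partial>\<^bsub>w\<^esub> f x)"
  by (rule has_derivative_linear[OF has_derivative_dir_deriv])

lemma dir_deriv_cong:
  assumes "open U" "x \<in> U" "\<And>y. y \<in> U \<Longrightarrow> f y = g y" "f differentiable at x"
  shows "\<partial>\<^bsub>w\<^esub> f x = \<partial>\<^bsub>w\<^esub> g x"
  unfolding dir_deriv_def
  by (subst frechet_derivative_transform_within_open[OF assms(4,1,2,3)]) simp_all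

lemma differentiable_cong_open:
  assumes "open U" "x \<in> U" "\<And>y. y \<in> U \<Longrightarrow> f y = g y" "f differentiable at x"
  shows "g differentiable at x"
  by (rule differentiableI,
      rule has_derivative_transform_within_open[OF has_derivative_dir_deriv[OF assms(4)] assms(1-3)])

lemma Ck_on_Suc_dir_deriv:
  "Ck_on (Suc k) f U \<longleftrightarrow> (\<forall>x\<in>U. f differentiable at x) \<and> (\<forall>v. Ck_on k (\<partial>\<^bsub>v\<^esub> f) U)"
  by (simp add: dir_deriv_def)

declare Ck_on.simps(2) [simp del]

lemma Ck_on_Suc_differentiable: "Ck_on (Suc k) f U \<Longrightarrow> x \<in> U \<Longrightarrow> f differentiable at x"
  by (simp add: Ck_on_Suc_dir_deriv)

lemma Ck_on_Suc_dir_derivD: "Ck_on (Suc k) f U \<Longrightarrow> Ck_on k (\<partial>\<^bsub>v\<^esub> f) U"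
  by (simp add: Ck_on_Suc_dir_deriv)

lemma Ck_on_Suc_imp: "Ck_on (Suc k) f U \<Longrightarrow> Ck_on k f U"
proof (induction k arbitrary: f)
  case 0
  then have "f differentiable at x" if "x \<in> U" for x
    using that by (rule Ck_on_Suc_differentiable)
  then show ?case
    by (simp add: continuous_at_imp_continuous_on differentiable_imp_continuous_within)
next
  case (Suc k)
  then show ?case
    using Ck_on_Suc_dir_deriv[of "Suc k" f U] Ck_on_Suc_dir_deriv[of k f U] by simp
qed

lemma Ck_on_cong:
  assumes "open U"
  shows "\<lbrakk>\<And>x. x \<in> U \<Longrightarrow> f x = g x; Ck_on k f U\<rbrakk> \<Longrightarrow> Ck_on k g U"
proof (induction k arbitrary: f g)
  case 0
  then show ?case by (simp cong: continuous_on_cong)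
next
  case (Suc k)
  note diff = Ck_on_Suc_differentiable[OF Suc.prems(2)]
  have "g differentiable at x" if "x \<in> U" for x
    by (rule differentiable_cong_open[OF assms that Suc.prems(1) diff[OF that]])
  moreover have "Ck_on k (\<partial>\<^bsub>v\<^esub> g) U" for v
  proof (rule Suc.IH[OF _ Ck_on_Suc_dir_derivD[OF Suc.prems(2)]])
    show "\<partial>\<^bsub>v\<^esub> f x = \<partial>\<^bsub>v\<^esub> g x" if "x \<in> U" for x
      by (rule dir_deriv_cong[OF assms that Suc.prems(1) diff[OF that]])
  qed
  ultimately show ?case
    by (simp add: Ck_on_Suc_dir_deriv)
qed

lemma Ck_on_const: "Ck_on k (\<lambda>x. c) U"
  by (induction k arbitrary: c) (simp_all add: Ck_on.simps)

lemma Ck_on_add: 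
  assumes "open U"
  shows "\<lbrakk>Ck_on k f U; Ck_on k g U\<rbrakk> \<Longrightarrow> Ck_on k (\<lambda>x. f x + g x) U"
proof (induction k arbitrary: f g)
  case 0
  then show ?case by (simp add: continuous_on_add)
next
  case (Suc k)
  have der: "((\<lambda>x. f x + g x) has_derivative (\<lambda>v. \<partial>\<^bsub>v\<^esub> f x + \<partial>\<^bsub>v\<^esub> g x)) (at x)" if "x \<in> U" for x
    using Suc.prems that
    by (intro has_derivative_add has_derivative_dir_deriv) (auto intro: Ck_on_Suc_differentiable)
  have "Ck_on k (\<lambda>x. \<partial>\<^bsub>v\<^esub> f x + \<partial>\<^bsub>v\<^esub> g x) U" for v
    by (intro Suc.IH Suc.prems[THEN Ck_on_Suc_dir_derivD])
  then have "Ck_on k (\<partial>\<^bsub>v\<^esub> (\<lambda>x. f x + g x)) U" for v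
    by (rule Ck_on_cong[OF assms, rotated]) (simp add: dir_deriv_eqI[OF der])
  then show ?case
    unfolding Ck_on_Suc_dir_deriv using differentiableI[OF der] by blast
qed

text \<open>
  All products in use (real, scalar and inner products, application and composition of operators) are
  bounded bilinear, so one Leibniz rule covers them.
\<close>
lemma (in bounded_bilinear) Ck_on_bilinear:
  assumes "open U"
  shows "\<lbrakk>Ck_on k f U; Ck_on k g U\<rbrakk> \<Longrightarrow> Ck_on k (\<lambda>x. prod (f x) (g x)) U"
proof (induction k arbitrary: f g)
  case 0
  then show ?case by (simp add: continuous_on)
next
  case (Suc k)
  have der: "((\<lambda>x. prod (f x) (g x)) has_derivative
      (\<lambda>v. prod (f x) (\<partial>\<^bsub>v\<^esub> g x) + prod (\<partial>\<^bsub>v\<^esub> f x) (g x))) (at x)" if "x \<in> U" for x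
    using Suc.prems that
    by (intro FDERIV has_derivative_dir_deriv) (auto intro: Ck_on_Suc_differentiable)
  have "Ck_on k (\<lambda>x. prod (f x) (\<partial>\<^bsub>v\<^esub> g x) + prod (\<partial>\<^bsub>v\<^esub> f x) (g x)) U" for v
    by (intro Ck_on_add[OF assms] Suc.IH Suc.prems[THEN Ck_on_Suc_imp]
        Suc.prems[THEN Ck_on_Suc_dir_derivD])
  then have "Ck_on k (\<partial>\<^bsub>v\<^esub> (\<lambda>x. prod (f x) (g x))) U" for v
    by (rule Ck_on_cong[OF assms, rotated]) (simp add: dir_deriv_eqI[OF der])
  then show ?case
    unfolding Ck_on_Suc_dir_deriv using differentiableI[OF der] by blast
qed

text \<open>The derivative of \<open>1/f\<close> is \<open>-(f' (1/f)) (1/f)\<close>, so the order of differentiability of \<open>1/f\<close>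
  bootstraps from that of \<open>f\<close>.\<close>
lemma Ck_on_inverse:
  fixes f :: "'a::real_normed_vector \<Rightarrow> real"
  assumes "open U" and nz: "\<And>x. x \<in> U \<Longrightarrow> f x \<noteq> 0"
  shows "Ck_on k f U \<Longrightarrow> Ck_on k (\<lambda>x. inverse (f x)) U"
proof (induction k)
  case 0
  then show ?case using nz by (simp add: continuous_on_inverse)
next
  case (Suc k)
  have der: "((\<lambda>x. inverse (f x)) has_derivative
      (\<lambda>v. - (inverse (f x) * \<partial>\<^bsub>v\<^esub> f x * inverse (f x)))) (at x)" if "x \<in> U" for x
    using Ck_on_Suc_differentiable[OF Suc.prems that] nz[OF that]
    by (intro Deriv.has_derivative_inverse has_derivative_dir_deriv)
  have eq: "(-1) * (inverse (f x) * \<partial>\<^bsub>v\<^esub> f x * inverse (f x)) = \<partial>\<^bsub>v\<^esub> (\<lambda>x. inverse (f x)) x"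
    if "x \<in> U" for x v
    using dir_deriv_eqI[OF der[OF that]] by simp
  have inv: "Ck_on k (\<lambda>x. inverse (f x)) U"
    using Suc.IH[OF Ck_on_Suc_imp[OF Suc.prems]] .
  note mult = bounded_bilinear.Ck_on_bilinear[OF bounded_bilinear_mult \<open>open U\<close>]
  have "Ck_on k (\<lambda>x. (-1) * (inverse (f x) * \<partial>\<^bsub>v\<^esub> f x * inverse (f x))) U" for v
    by (rule mult[OF Ck_on_const mult[OF mult[OF inv Ck_on_Suc_dir_derivD[OF Suc.prems]] inv]])
  then have "Ck_on k (\<partial>\<^bsub>v\<^esub> (\<lambda>x. inverse (f x))) U" for v
    by (rule Ck_on_cong[OF \<open>open U\<close>, rotated]) (rule eq)
  then show ?case
    unfolding Ck_on_Suc_dir_deriv using differentiableI[OF der] by blast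
qed

lemma smooth_map_differentiable: "smooth_map U f \<Longrightarrow> x \<in> U \<Longrightarrow> f differentiable at x"
  unfolding smooth_map_def by (rule Ck_on_Suc_differentiable[of 0]) auto

lemma smooth_map_has_derivative:
  "smooth_map U f \<Longrightarrow> x \<in> U \<Longrightarrow> (f has_derivative (\<lambda>w. \<partial>\<^bsub>w\<^esub> f x)) (at x)"
  by (simp add: has_derivative_dir_deriv smooth_map_differentiable)

lemma smooth_map_dir_deriv: "smooth_map U f \<Longrightarrow> smooth_map U (\<partial>\<^bsub>v\<^esub> f)"
  by (auto simp: smooth_map_def intro: Ck_on_Suc_dir_derivD)

lemma smooth_map_cong:
  "open U \<Longrightarrow> (\<And>x. x \<in> U \<Longrightarrow> f x = g x) \<Longrightarrow> smooth_map U f \<Longrightarrow> smooth_map U g"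
  unfolding smooth_map_def by (auto intro: Ck_on_cong)

lemma smooth_map_const: "smooth_map U (\<lambda>x. c)"
  by (simp add: smooth_map_def Ck_on_const)

lemma smooth_map_add:
  "open U \<Longrightarrow> smooth_map U f \<Longrightarrow> smooth_map U g \<Longrightarrow> smooth_map U (\<lambda>x. f x + g x)"
  by (simp add: smooth_map_def Ck_on_add)

lemma (in bounded_bilinear) smooth_map_bilinear:
  "open U \<Longrightarrow> smooth_map U f \<Longrightarrow> smooth_map U g \<Longrightarrow> smooth_map U (\<lambda>x. prod (f x) (g x))"
  by (simp add: smooth_map_def Ck_on_bilinear)

lemmas smooth_map_inner = bounded_bilinear.smooth_map_bilinear[OF bounded_bilinear_inner]
  and smooth_map_mult = bounded_bilinear.smooth_map_bilinear[OF bounded_bilinear_mult]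
  and smooth_map_scaleR = bounded_bilinear.smooth_map_bilinear[OF bounded_bilinear_scaleR]
  and smooth_map_blinfun_apply =
    bounded_bilinear.smooth_map_bilinear[OF bounded_bilinear_blinfun_apply]
  and smooth_map_blinfun_compose =
    bounded_bilinear.smooth_map_bilinear[OF bounded_bilinear_blinfun_compose]

text \<open>
  A bounded linear map is treated as the bilinear map \<open>(c, y) \<mapsto> c L(y)\<close> with \<open>c = 1\<close>.
\<close>
lemma smooth_map_linear:
  assumes "open U" "bounded_linear L" "smooth_map U f"
  shows "smooth_map U (\<lambda>x. L (f x))"
proof -
  have "bounded_bilinear (\<lambda>(c::real) y. c *\<^sub>R L y)"
    by (rule bounded_bilinear.comp[OF bounded_bilinear_scaleR bounded_linear_ident assms(2)])
  from bounded_bilinear.smooth_map_bilinear[OF this assms(1) smooth_map_const[of U 1] assms(3)]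
  show ?thesis by simp
qed

lemma smooth_map_uminus: "open U \<Longrightarrow> smooth_map U f \<Longrightarrow> smooth_map U (\<lambda>x. - f x)"
  by (rule smooth_map_linear) (auto intro: bounded_linear_minus bounded_linear_ident)

lemma smooth_map_diff:
  "open U \<Longrightarrow> smooth_map U f \<Longrightarrow> smooth_map U g \<Longrightarrow> smooth_map U (\<lambda>x. f x - g x)"
  using smooth_map_add[OF _ _ smooth_map_uminus, of U f g] by simp

lemma smooth_map_sum:
  "open U \<Longrightarrow> (\<And>i. i \<in> I \<Longrightarrow> smooth_map U (f i)) \<Longrightarrow> smooth_map U (\<lambda>x. \<Sum>i\<in>I. f i x)"
  by (induction I rule: infinite_finite_induct) (auto intro: smooth_map_const smooth_map_add)

lemma smooth_map_prod:
  fixes f :: "'i \<Rightarrow> 'a::real_normed_vector \<Rightarrow> real"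
  shows "open U \<Longrightarrow> (\<And>i. i \<in> I \<Longrightarrow> smooth_map U (f i)) \<Longrightarrow> smooth_map U (\<lambda>x. \<Prod>i\<in>I. f i x)"
  by (induction I rule: infinite_finite_induct) (auto intro: smooth_map_const smooth_map_mult)

lemma smooth_map_divide:
  fixes f :: "'a::real_normed_vector \<Rightarrow> real"
  assumes "open U" "smooth_map U f" "smooth_map U g" "\<And>x. x \<in> U \<Longrightarrow> g x \<noteq> 0"
  shows "smooth_map U (\<lambda>x. f x / g x)"
  unfolding divide_inverse using assms 
  by (intro smooth_map_mult) (auto simp: smooth_map_def Ck_on_inverse)

lemmas smooth_map_intros = smooth_map_const smooth_map_add smooth_map_diff smooth_map_uminus
  smooth_map_sum smooth_map_prod smooth_map_inner smooth_map_mult smooth_map_scaleR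
  smooth_map_blinfun_apply smooth_map_dir_deriv

lemma (in bounded_bilinear) dir_deriv_bilinear:
  "f differentiable at x \<Longrightarrow> g differentiable at x \<Longrightarrow>
    \<partial>\<^bsub>v\<^esub> (\<lambda>x. prod (f x) (g x)) x = prod (f x) (\<partial>\<^bsub>v\<^esub> g x) + prod (\<partial>\<^bsub>v\<^esub> f x) (g x)"
  by (simp add: dir_deriv_eqI[OF FDERIV[OF has_derivative_dir_deriv has_derivative_dir_deriv]])

lemmas dir_deriv_inner = bounded_bilinear.dir_deriv_bilinear[OF bounded_bilinear_inner]
  and dir_deriv_scaleR = bounded_bilinear.dir_deriv_bilinear[OF bounded_bilinear_scaleR]
  and dir_deriv_blinfun_apply =
    bounded_bilinear.dir_deriv_bilinear[OF bounded_bilinear_blinfun_apply]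

lemma dir_deriv_const: "\<partial>\<^bsub>v\<^esub> (\<lambda>x. c) x = 0"
  by (simp add: dir_deriv_def)

lemma dir_deriv_add:
  "f differentiable at x \<Longrightarrow> g differentiable at x \<Longrightarrow>
    \<partial>\<^bsub>v\<^esub> (\<lambda>x. f x + g x) x = \<partial>\<^bsub>v\<^esub> f x + \<partial>\<^bsub>v\<^esub> g x"
  by (simp add: dir_deriv_eqI[OF has_derivative_add[OF has_derivative_dir_deriv has_derivative_dir_deriv]])

lemma dir_deriv_uminus:
  "f differentiable at x \<Longrightarrow> \<partial>\<^bsub>v\<^esub> (\<lambda>x. - f x) x = - \<partial>\<^bsub>v\<^esub> f x"
  by (simp add: dir_deriv_eqI[OF has_derivative_minus[OF has_derivative_dir_deriv]])

lemma dir_deriv_linear: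
  "bounded_linear L \<Longrightarrow> f differentiable at x \<Longrightarrow> \<partial>\<^bsub>v\<^esub> (\<lambda>x. L (f x)) x = L (\<partial>\<^bsub>v\<^esub> f x)"
  by (simp add: dir_deriv_eqI[OF bounded_linear.has_derivative[OF _ has_derivative_dir_deriv]])

lemma dir_deriv_line:
  fixes f :: "'a::real_normed_vector \<Rightarrow> real"
  assumes "f differentiable at (x + t *\<^sub>R v)"
  shows "((\<lambda>s. f (x + s *\<^sub>R v)) has_real_derivative \<partial>\<^bsub>v\<^esub> f (x + t *\<^sub>R v)) (at t)"
proof -
  have "((\<lambda>s. f (x + s *\<^sub>R v)) has_derivative (\<lambda>s. \<partial>\<^bsub>s *\<^sub>R v\<^esub> f (x + t *\<^sub>R v))) (at t)"
    by (rule has_derivative_compose[where g = f and f = "\<lambda>s. x + s *\<^sub>R v" and f' = "\<lambda>s. s *\<^sub>R v"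
          and g' = "\<lambda>w. \<partial>\<^bsub>w\<^esub> f (x + t *\<^sub>R v)"])
       (auto intro!: derivative_eq_intros has_derivative_dir_deriv assms)
  moreover have "(\<lambda>s. \<partial>\<^bsub>s *\<^sub>R v\<^esub> f (x + t *\<^sub>R v)) = (\<lambda>s. \<partial>\<^bsub>v\<^esub> f (x + t *\<^sub>R v) * s)"
    using linear_cmul[OF linear_dir_deriv[OF assms]] by (simp add: mult.commute)
  ultimately show ?thesis
    by (simp add: has_field_derivative_def)
qed

lemma second_difference_mean_value:
  fixes f :: "'a::real_normed_vector \<Rightarrow> real"
  assumes "h > 0"
    and par: "\<And>s t. \<lbrakk>0 \<le> s; s \<le> h; 0 \<le> t; t \<le> h\<rbrakk> \<Longrightarrow> x + s *\<^sub>R v + t *\<^sub>R w \<in> U"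
    and f: "\<And>y. y \<in> U \<Longrightarrow> f differentiable at y"
    and f': "\<And>y. y \<in> U \<Longrightarrow> \<partial>\<^bsub>v\<^esub> f differentiable at y"
  obtains s t where "0 \<le> s" "s \<le> h" "0 \<le> t" "t \<le> h"
    "f (x + h *\<^sub>R v + h *\<^sub>R w) - f (x + h *\<^sub>R v) - f (x + h *\<^sub>R w) + f x
       = h\<^sup>2 * \<partial>\<^bsub>w\<^esub> (\<partial>\<^bsub>v\<^esub> f) (x + s *\<^sub>R v + t *\<^sub>R w)"
proof -
  define \<psi> where "\<psi> s = f ((x + h *\<^sub>R w) + s *\<^sub>R v) - f (x + s *\<^sub>R v)" for s
  have "(\<psi> has_real_derivative 
      \<partial>\<^bsub>v\<^esub> f ((x + h *\<^sub>R w) + s *\<^sub>R v) - \<partial>\<^bsub>v\<^esub> f (x + s *\<^sub>R v)) (at s)"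
    if "0 \<le> s" "s \<le> h" for s
    unfolding \<psi>_def using par[of s h] par[of s 0] that \<open>h > 0\<close>
    by (intro DERIV_diff dir_deriv_line f) (auto simp: algebra_simps)
  from MVT2[OF \<open>h > 0\<close>, of \<psi>, OF this] obtain s where s: "0 < s" "s < h"
    "\<psi> h - \<psi> 0 = h * (\<partial>\<^bsub>v\<^esub> f ((x + h *\<^sub>R w) + s *\<^sub>R v) - \<partial>\<^bsub>v\<^esub> f (x + s *\<^sub>R v))"
    by auto
  have "((\<lambda>t. \<partial>\<^bsub>v\<^esub> f ((x + s *\<^sub>R v) + t *\<^sub>R w)) has_real_derivative
      \<partial>\<^bsub>w\<^esub> (\<partial>\<^bsub>v\<^esub> f) ((x + s *\<^sub>R v) + t *\<^sub>R w)) (at t)"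
    if "0 \<le> t" "t \<le> h" for t
    using par[of s t] that s by (intro dir_deriv_line f') auto
  from MVT2[OF \<open>h > 0\<close> this] obtain t where t: "0 < t" "t < h"
    "\<partial>\<^bsub>v\<^esub> f ((x + s *\<^sub>R v) + h *\<^sub>R w) - \<partial>\<^bsub>v\<^esub> f (x + s *\<^sub>R v)
      = h * \<partial>\<^bsub>w\<^esub> (\<partial>\<^bsub>v\<^esub> f) ((x + s *\<^sub>R v) + t *\<^sub>R w)"
    by auto
  have "f (x + h *\<^sub>R v + h *\<^sub>R w) - f (x + h *\<^sub>R v) - f (x + h *\<^sub>R w) + f x = \<psi> h - \<psi> 0"
    by (simp add: \<psi>_def algebra_simps)
  also have "\<dots> = h\<^sup>2 * \<partial>\<^bsub>w\<^esub> (\<partial>\<^bsub>v\<^esub> f) (x + s *\<^sub>R v + t *\<^sub>R w)"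
    using s t by (simp add: power2_eq_square algebra_simps)
  finally show ?thesis
    using that[of s t] s t by simp
qed

text \<open>
  By two applications of the mean value theorem, the second difference of \<open>f\<close> over a small parallelogram
  is a multiple of a value of either mixed derivative nearby, with the same factor. So different values of
  the mixed derivatives at \<open>x\<close> would contradict their continuity.
\<close>
lemma dir_deriv_commute_real:
  fixes f :: "'a::real_normed_vector \<Rightarrow> real"
  assumes "open U" "smooth_map U f" "x \<in> U"
  shows "\<partial>\<^bsub>v\<^esub> (\<partial>\<^bsub>w\<^esub> f) x = \<partial>\<^bsub>w\<^esub> (\<partial>\<^bsub>v\<^esub> f) x"
proof (rule ccontr)
  assume neq: "\<not> ?thesis"
  define e where "e = \<bar>\<partial>\<^bsub>v\<^esub> (\<partial>\<^bsub>w\<^esub> f) x - \<partial>\<^bsub>w\<^esub> (\<partial>\<^bsub>v\<^esub> f) x\<bar> / 2"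
  have "e > 0" using neq by (simp add: e_def)
  have cont: "continuous (at x) (\<partial>\<^bsub>a\<^esub> (\<partial>\<^bsub>b\<^esub> f))" for a b
    using smooth_map_differentiable[OF _ \<open>x \<in> U\<close>] assms(2)
    by (intro differentiable_imp_continuous_within) (auto intro: smooth_map_dir_deriv)
  obtain d where d: "d > 0" "ball x d \<subseteq> U"
    "\<And>y. dist y x < d \<Longrightarrow> \<bar>\<partial>\<^bsub>v\<^esub> (\<partial>\<^bsub>w\<^esub> f) y - \<partial>\<^bsub>v\<^esub> (\<partial>\<^bsub>w\<^esub> f) x\<bar> < e"
    "\<And>y. dist y x < d \<Longrightarrow> \<bar>\<partial>\<^bsub>w\<^esub> (\<partial>\<^bsub>v\<^esub> f) y - \<partial>\<^bsub>w\<^esub> (\<partial>\<^bsub>v\<^esub> f) x\<bar> < e"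
  proof -
    obtain d1 where "d1 > 0" "ball x d1 \<subseteq> U"
      using assms open_contains_ball by blast
    moreover obtain d2 where "d2 > 0"
      "\<And>y. dist y x < d2 \<Longrightarrow> \<bar>\<partial>\<^bsub>v\<^esub> (\<partial>\<^bsub>w\<^esub> f) y - \<partial>\<^bsub>v\<^esub> (\<partial>\<^bsub>w\<^esub> f) x\<bar> < e"
      using cont[of v w] \<open>e > 0\<close> unfolding continuous_at_eps_delta dist_real_def by meson
    moreover obtain d3 where "d3 > 0"
      "\<And>y. dist y x < d3 \<Longrightarrow> \<bar>\<partial>\<^bsub>w\<^esub> (\<partial>\<^bsub>v\<^esub> f) y - \<partial>\<^bsub>w\<^esub> (\<partial>\<^bsub>v\<^esub> f) x\<bar> < e"
      using cont[of w v] \<open>e > 0\<close> unfolding continuous_at_eps_delta dist_real_def by meson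
    ultimately show ?thesis
      using that[of "min d1 (min d2 d3)"] by fastforce
  qed
  \<comment> \<open>The parallelogram with sides \<open>h v\<close> and \<open>h w\<close> then lies in the ball of radius \<open>d\<close>; the
    summand \<open>1\<close> covers \<open>v = w = 0\<close>.\<close>
  define h where "h = d / (norm v + norm w + 1)"
  have "h > 0" using d(1) by (simp add: h_def add_nonneg_pos)
  have near: "dist (x + s *\<^sub>R v + t *\<^sub>R w) x < d" if "0 \<le> s" "s \<le> h" "0 \<le> t" "t \<le> h" for s t
  proof -
    have "dist (x + s *\<^sub>R v + t *\<^sub>R w) x \<le> s * norm v + t * norm w"
      using norm_triangle_ineq[of "s *\<^sub>R v" "t *\<^sub>R w"] that by (simp add: dist_norm add.assoc)
    also have "\<dots> \<le> h * norm v + h * norm w"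
      using that by (intro add_mono mult_right_mono) auto
    also have "\<dots> < h * (norm v + norm w + 1)"
      using \<open>h > 0\<close> by (simp add: algebra_simps)
    also have "\<dots> = d"
      by (simp add: h_def add_nonneg_pos less_imp_neq[symmetric])
    finally show ?thesis .
  qed
  then have near': "dist (x + t *\<^sub>R w + s *\<^sub>R v) x < d" if "0 \<le> s" "s \<le> h" "0 \<le> t" "t \<le> h" for s t
    using that by (metis add.assoc add.commute)
  have inU: "y \<in> U" if "dist y x < d" for y
    using d(2) that by (auto simp: dist_commute)
  have diff: "f differentiable at y" "\<partial>\<^bsub>a\<^esub> f differentiable at y" if "y \<in> U" for y a
    using smooth_map_differentiable[OF _ that] assms(2) by (auto intro: smooth_map_dir_deriv)
  obtain s t where st: "0 \<le> s" "s \<le> h" "0 \<le> t" "t \<le> h"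
    "f (x + h *\<^sub>R v + h *\<^sub>R w) - f (x + h *\<^sub>R v) - f (x + h *\<^sub>R w) + f x
       = h\<^sup>2 * \<partial>\<^bsub>w\<^esub> (\<partial>\<^bsub>v\<^esub> f) (x + s *\<^sub>R v + t *\<^sub>R w)"
    by (rule second_difference_mean_value[OF \<open>h > 0\<close>, of x v w U f]) (auto intro: diff inU near)
  obtain s' t' where st': "0 \<le> s'" "s' \<le> h" "0 \<le> t'" "t' \<le> h"
    "f (x + h *\<^sub>R w + h *\<^sub>R v) - f (x + h *\<^sub>R w) - f (x + h *\<^sub>R v) + f x
       = h\<^sup>2 * \<partial>\<^bsub>v\<^esub> (\<partial>\<^bsub>w\<^esub> f) (x + s' *\<^sub>R w + t' *\<^sub>R v)"
    by (rule second_difference_mean_value[OF \<open>h > 0\<close>, of x w v U f]) (auto intro: diff inU near')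
  have "x + h *\<^sub>R w + h *\<^sub>R v = x + h *\<^sub>R v + h *\<^sub>R w"
    by (simp add: algebra_simps)
  then have "h\<^sup>2 * \<partial>\<^bsub>w\<^esub> (\<partial>\<^bsub>v\<^esub> f) (x + s *\<^sub>R v + t *\<^sub>R w)
      = h\<^sup>2 * \<partial>\<^bsub>v\<^esub> (\<partial>\<^bsub>w\<^esub> f) (x + s' *\<^sub>R w + t' *\<^sub>R v)"
    using st(5) st'(5) by (simp add: algebra_simps)
  then have "\<partial>\<^bsub>w\<^esub> (\<partial>\<^bsub>v\<^esub> f) (x + s *\<^sub>R v + t *\<^sub>R w)
      = \<partial>\<^bsub>v\<^esub> (\<partial>\<^bsub>w\<^esub> f) (x + s' *\<^sub>R w + t' *\<^sub>R v)"
    using \<open>h > 0\<close> by simp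
  moreover have False if "a = b" "\<bar>a - c\<bar> < \<bar>d - c\<bar> / 2" "\<bar>b - d\<bar> < \<bar>d - c\<bar> / 2" for a b c d :: real
    using that by (auto simp: abs_if split: if_splits)
  ultimately show False
    using d(4)[OF near[OF st(1-4)]] d(3)[OF near'[OF st'(3,4,1,2)]] unfolding e_def by blast
qed

text \<open>
  The scalar case is applied to each coordinate.
\<close>
lemma dir_deriv_commute:
  fixes f :: "'a::real_normed_vector \<Rightarrow> 'b::euclidean_space"
  assumes "open U" "smooth_map U f" "x \<in> U"
  shows "\<partial>\<^bsub>v\<^esub> (\<partial>\<^bsub>w\<^esub> f) x = \<partial>\<^bsub>w\<^esub> (\<partial>\<^bsub>v\<^esub> f) x"
proof (rule euclidean_eqI)
  fix b :: 'b assume "b \<in> Basis"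
  have comp: "\<partial>\<^bsub>p\<^esub> (\<lambda>y. g y \<bullet> b) y = \<partial>\<^bsub>p\<^esub> g y \<bullet> b" if "smooth_map U g" "y \<in> U" for g y p
    by (rule dir_deriv_linear[OF bounded_linear_inner_left smooth_map_differentiable[OF that]])
  have sm: "smooth_map U (\<lambda>y. g y \<bullet> b)" if "smooth_map U g" for g
    by (rule smooth_map_linear[OF assms(1) bounded_linear_inner_left that])
  have "\<partial>\<^bsub>p\<^esub> (\<partial>\<^bsub>q\<^esub> f) x \<bullet> b = \<partial>\<^bsub>p\<^esub> (\<partial>\<^bsub>q\<^esub> (\<lambda>y. f y \<bullet> b)) x" for p q
  proof -
    have "\<partial>\<^bsub>p\<^esub> (\<partial>\<^bsub>q\<^esub> f) x \<bullet> b = \<partial>\<^bsub>p\<^esub> (\<lambda>y. \<partial>\<^bsub>q\<^esub> f y \<bullet> b) x"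
      using comp[OF smooth_map_dir_deriv[OF assms(2)] assms(3)] by simp
    also have "\<dots> = \<partial>\<^bsub>p\<^esub> (\<partial>\<^bsub>q\<^esub> (\<lambda>y. f y \<bullet> b)) x"
      using comp[OF assms(2)] smooth_map_differentiable[OF sm[OF smooth_map_dir_deriv[OF assms(2)]] assms(3)]
      by (intro dir_deriv_cong[OF assms(1,3)]) auto
    finally show ?thesis .
  qed
  then show "\<partial>\<^bsub>v\<^esub> (\<partial>\<^bsub>w\<^esub> f) x \<bullet> b = \<partial>\<^bsub>w\<^esub> (\<partial>\<^bsub>v\<^esub> f) x \<bullet> b"
    using dir_deriv_commute_real[OF assms(1) sm[OF assms(2)] assms(3)] by simp
qed

section \<open>Smooth dependence of determinants and inverse matrices\<close>

lemma dir_deriv_zero: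
  assumes "open U" "x \<in> U" "\<And>y. y \<in> U \<Longrightarrow> f y = c"
  shows "\<partial>\<^bsub>w\<^esub> f x = 0"
proof -
  have "\<partial>\<^bsub>w\<^esub> (\<lambda>_. c) x = \<partial>\<^bsub>w\<^esub> f x"
    by (rule dir_deriv_cong[OF assms(1,2)]) (simp_all add: assms(3))
  then show ?thesis by (simp add: dir_deriv_const)
qed

lemma smooth_map_det:
  fixes A :: "'a::real_normed_vector \<Rightarrow> real^'n^'n"
  assumes "open U" "\<And>i j. smooth_map U (\<lambda>x. A x $ i $ j)"
  shows "smooth_map U (\<lambda>x. det (A x))"
  unfolding det_def using assms by (intro smooth_map_intros) auto

lemma matrix_inv_works:
  fixes A :: "real^'n^'n"
  assumes "invertible A"
  shows "A ** matrix_inv A = mat 1" "matrix_inv A ** A = mat 1"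
  using someI_ex[OF assms[unfolded invertible_def]] unfolding matrix_inv_def by auto

text \<open>
  Cramer's rule makes the entries of the inverse rational functions of the entries, which gives their
  smoothness.
\<close>
lemma matrix_inv_eq_cramer:
  fixes A :: "real^'n^'n"
  assumes "invertible A"
  shows "matrix_inv A $ k $ l =
    det (\<chi> i j. if j = k then axis l 1 $ i else A $ i $ j) / det A"
proof -
  have "A ** matrix_inv A = mat 1"
    using assms by (rule matrix_inv_works)
  then have "A *v (matrix_inv A *v axis l 1) = axis l 1"
    by (simp add: matrix_vector_mul_assoc)
  then have "matrix_inv A *v axis l 1
      = (\<chi> k. det (\<chi> i j. if j = k then axis l 1 $ i else A $ i $ j) / det A)"
    using cramer[of A] assms by (simp add: invertible_det_nz)
  then have "(matrix_inv A *v axis l 1) $ k =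
      det (\<chi> i j. if j = k then axis l 1 $ i else A $ i $ j) / det A"
    by simp
  then show ?thesis
    by (simp add: matrix_vector_mul_component inner_axis)
qed

lemma smooth_map_matrix_inv:
  fixes A :: "'a::real_normed_vector \<Rightarrow> real^'n^'n"
  assumes "open U" "\<And>i j. smooth_map U (\<lambda>x. A x $ i $ j)" "\<And>x. x \<in> U \<Longrightarrow> invertible (A x)"
  shows "smooth_map U (\<lambda>x. matrix_inv (A x) $ k $ l)"
proof (rule smooth_map_cong[OF assms(1)])
  show "smooth_map U (\<lambda>x. det (\<chi> i j. if j = k then axis l 1 $ i else A x $ i $ j) / det (A x))"
  proof (intro smooth_map_divide smooth_map_det assms(1))
    show "smooth_map U (\<lambda>x. (\<chi> i j. if j = k then axis l 1 $ i else A x $ i $ j) $ i $ j)" for i j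
      by (cases "j = k") (simp_all add: smooth_map_const assms(2))
    show "det (A x) \<noteq> 0" if "x \<in> U" for x
      using assms(3)[OF that] by (simp add: invertible_det_nz)
  qed (rule assms(2))
qed (simp add: matrix_inv_eq_cramer assms(3))

section \<open>Eigenvectors of self-adjoint operators\<close>

text \<open>
  Spectral theorem. A maximizer of \<open>f x \<bullet> x\<close> on the unit sphere of \<open>W\<close> is an
  eigenvector, its orthogonal complement in \<open>W\<close> is invariant, and one proceeds by induction on the
  dimension.
\<close>
lemma self_adjoint_eigenbasis:
  fixes f :: "'a::euclidean_space \<Rightarrow> 'a"
  assumes "linear f"
  shows "\<lbrakk>subspace W; f ` W \<subseteq> W; \<And>x y. x \<in> W \<Longrightarrow> y \<in> W \<Longrightarrow> f x \<bullet> y = x \<bullet> f y\<rbrakk> \<Longrightarrow>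
    \<exists>B. B \<subseteq> W \<and> finite B \<and> card B = dim W \<and> span B = W \<and> pairwise orthogonal B \<and>
        (\<forall>b\<in>B. norm b = 1 \<and> (\<exists>c. f b = c *\<^sub>R b))"
proof (induction "dim W" arbitrary: W)
  case 0
  then have "W = {0}"
    using dim_eq_0[of W] subspace_0[of W] by auto
  then show ?case
    by (intro exI[of _ "{}"]) auto
next
  case (Suc k)
  interpret f: linear f by fact
  have "compact (sphere 0 1 \<inter> W)"
    using closed_subspace[OF Suc.prems(1)] by (simp add: compact_Int_closed)
  moreover have "sphere 0 1 \<inter> W \<noteq> {}"
  proof -
    have "\<not> W \<subseteq> {0}"
      using Suc.hyps(2) by (simp flip: dim_eq_0)
    then obtain x where x: "x \<in> W" "x \<noteq> 0"
      by blast
    then have "(1 / norm x) *\<^sub>R x \<in> sphere 0 1 \<inter> W"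
      using Suc.prems(1) by (simp add: subspace_scale)
    then show ?thesis by blast
  qed
  moreover have "continuous_on (sphere 0 1 \<inter> W) (\<lambda>x. f x \<bullet> x)"
    by (intro continuous_intros linear_continuous_on) (simp add: assms flip: linear_conv_bounded_linear)
  ultimately obtain b where b: "b \<in> sphere 0 1 \<inter> W"
    and max: "\<And>x. x \<in> sphere 0 1 \<inter> W \<Longrightarrow> f x \<bullet> x \<le> f b \<bullet> b"
    using continuous_attains_sup[of "sphere 0 1 \<inter> W" "\<lambda>x. f x \<bullet> x"] by blast
  have bW: "b \<in> W" and b1: "norm b = 1" and bb: "b \<bullet> b = 1"
    using b by (auto simp: dot_square_norm)
  define c where "c = f b \<bullet> b"
  have le: "0 \<le> c * (x \<bullet> x) - f x \<bullet> x" if "x \<in> W" for x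
  proof (cases "x = 0")
    case False
    define y where "y = (1 / norm x) *\<^sub>R x"
    have "y \<in> sphere 0 1 \<inter> W"
      using False that Suc.prems(1) by (simp add: y_def subspace_scale)
    then have "f y \<bullet> y \<le> c" using max by (simp add: c_def)
    moreover have "f x \<bullet> x = (f y \<bullet> y) * (x \<bullet> x)"
      using False by (simp add: y_def f.scale dot_square_norm power2_eq_square)
    ultimately show ?thesis
      by (simp add: mult_right_mono)
  qed (simp add: f.zero)
  \<comment> \<open>The residual \<open>r\<close> vanishes, as otherwise moving from \<open>b\<close> along it would increase the quotient.\<close>
  define r where "r = f b - c *\<^sub>R b"
  have rW: "r \<in> W"
    unfolding r_def using Suc.prems(1,2) bW by (intro subspace_diff subspace_scale) auto
  have eig: "f b = c *\<^sub>R b"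
  proof (rule ccontr)
    assume "f b \<noteq> c *\<^sub>R b"
    then have rr: "r \<bullet> r > 0" by (simp add: r_def)
    define q where "q = c * (r \<bullet> r) - f r \<bullet> r"
    define t where "t = (r \<bullet> r) / (q + 1)"
    have "q \<ge> 0" using le[OF rW] by (simp add: q_def)
    then have "t > 0" "t * q \<le> r \<bullet> r" using rr by (auto simp: t_def field_simps)
    have "b + t *\<^sub>R r \<in> W"
      using Suc.prems(1) bW rW by (intro subspace_add subspace_scale)
    from le[OF this] have "0 \<le> c * (1 + 2 * t * (b \<bullet> r) + t\<^sup>2 * (r \<bullet> r))
        - (c + t * (f b \<bullet> r) + t * (f r \<bullet> b) + t\<^sup>2 * (f r \<bullet> r))"
      by (simp add: f.add f.scale inner_add_left inner_add_right bb c_def inner_commute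
          power2_eq_square algebra_simps)
    also have "f r \<bullet> b = f b \<bullet> r"
      using Suc.prems(3)[OF rW bW] by (simp add: inner_commute)
    also have "c * (1 + 2 * t * (b \<bullet> r) + t\<^sup>2 * (r \<bullet> r))
        - (c + t * (f b \<bullet> r) + t * (f b \<bullet> r) + t\<^sup>2 * (f r \<bullet> r)) = t * (t * q - 2 * (r \<bullet> r))"
    proof -
      have "f b \<bullet> r = r \<bullet> r + c * (b \<bullet> r)"
        by (simp add: r_def inner_diff_left)
      then show ?thesis
        by (simp add: q_def power2_eq_square algebra_simps)
    qed
    finally show False
      using \<open>t > 0\<close> \<open>t * q \<le> r \<bullet> r\<close> rr by (simp add: zero_le_mult_iff)
  qed
  define W' where "W' = {y \<in> W. \<forall>x\<in>span {b}. orthogonal x y}"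
  have W': "W' = {y \<in> W. b \<bullet> y = 0}"
    by (auto simp: W'_def orthogonal_def span_singleton)
  have dimW': "dim W' + dim (span {b}) = dim W"
    unfolding W'_def using bW Suc.prems(1)
    by (intro dim_subspace_orthogonal_to_vectors) (auto simp: span_minimal subspace_span)
  have "dim (span {b}) = 1"
    using b1 by (auto simp: dim_insert)
  then have k: "k = dim W'" using dimW' Suc.hyps(2) by simp
  have subW': "subspace W'"
    using Suc.prems(1) unfolding W' subspace_def by (auto simp: inner_add_right)
  have "f ` W' \<subseteq> W'"
  proof
    fix y assume "y \<in> f ` W'"
    then obtain x where x: "x \<in> W" "b \<bullet> x = 0" "y = f x" by (auto simp: W')
    then have "b \<bullet> f x = f b \<bullet> x" using Suc.prems(3)[OF bW x(1)] by simp
    then show "y \<in> W'" using x Suc.prems(2) by (auto simp: W' eig)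
  qed
  moreover have "f x \<bullet> y = x \<bullet> f y" if "x \<in> W'" "y \<in> W'" for x y
    using Suc.prems(3)[of x y] that by (simp add: W')
  ultimately have "\<exists>B. B \<subseteq> W' \<and> finite B \<and> card B = dim W' \<and> span B = W' \<and> pairwise orthogonal B \<and>
      (\<forall>b\<in>B. norm b = 1 \<and> (\<exists>c. f b = c *\<^sub>R b))"
    by (rule Suc.hyps(1)[OF k subW'])
  then obtain B where B: "B \<subseteq> W'" "finite B" "card B = k" "pairwise orthogonal B"
    "\<And>b. b \<in> B \<Longrightarrow> norm b = 1 \<and> (\<exists>c. f b = c *\<^sub>R b)"
    unfolding k by auto
  have "b \<notin> B" using B(1) bb by (auto simp: W')
  have orth: "pairwise orthogonal (insert b B)"
    using B(1,4) by (auto simp: pairwise_insert W' orthogonal_def inner_commute)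
  have ind: "independent (insert b B)"
    using orth b1 B(5) by (intro pairwise_orthogonal_independent) force+
  have card: "card (insert b B) = dim W"
    using \<open>b \<notin> B\<close> B(2,3) Suc.hyps(2) by simp
  have sub: "insert b B \<subseteq> W" using B(1) bW by (auto simp: W')
  have "span (insert b B) = W"
    using card_ge_dim_independent[OF sub ind] card span_minimal[OF sub Suc.prems(1)] by auto
  then show ?case
    using B(2,5) orth card sub b1 eig by (intro exI[of _ "insert b B"]) auto
qed

text \<open>
  Eigenspaces for distinct eigenvalues are orthogonal, so orthonormal bases of them unite to an
  independent subset of \<open>W\<close>.
\<close>
lemma sum_dim_eigenspaces_le:
  fixes f :: "'a::euclidean_space \<Rightarrow> 'a"
  assumes "linear f" "subspace W" "finite K"
    and sa: "\<And>x y. x \<in> W \<Longrightarrow> y \<in> W \<Longrightarrow> f x \<bullet> y = x \<bullet> f y"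
  shows "(\<Sum>\<kappa>\<in>K. dim {v \<in> W. f v = \<kappa> *\<^sub>R v}) \<le> dim W"
proof -
  interpret f: linear f by fact
  define E where "E \<kappa> = {v \<in> W. f v = \<kappa> *\<^sub>R v}" for \<kappa>
  have sub: "subspace (E \<kappa>)" for \<kappa>
    using assms(2)
    by (auto simp: E_def subspace_def f.zero f.add f.scale scaleR_right_distrib mult.commute)
  have "\<exists>B. B \<subseteq> E \<kappa> \<and> pairwise orthogonal B \<and> 0 \<notin> B \<and> finite B \<and> card B = dim (E \<kappa>)" for \<kappa>
  proof -
    obtain B where B: "B \<subseteq> E \<kappa>" "pairwise orthogonal B" "independent B" "card B = dim (E \<kappa>)"
      by (rule orthonormal_basis_subspace[OF sub[of \<kappa>]]) (rule that)
    moreover have "0 \<notin> B" using B(3) dependent_zero by blast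
    ultimately show ?thesis using independent_imp_finite[OF B(3)] by (intro exI[of _ B]) simp
  qed
  then obtain B where B: "\<And>\<kappa>. B \<kappa> \<subseteq> E \<kappa>" "\<And>\<kappa>. pairwise orthogonal (B \<kappa>)" "\<And>\<kappa>. 0 \<notin> B \<kappa>"
    "\<And>\<kappa>. finite (B \<kappa>)" "\<And>\<kappa>. card (B \<kappa>) = dim (E \<kappa>)"
    by metis
  have orth: "orthogonal x y" if "x \<in> B \<kappa>" "y \<in> B \<mu>" "\<kappa> \<noteq> \<mu>" for x y \<kappa> \<mu>
  proof -
    have x: "x \<in> W" "f x = \<kappa> *\<^sub>R x" and y: "y \<in> W" "f y = \<mu> *\<^sub>R y"
      using B(1) that by (auto simp: E_def)
    then have "\<kappa> * (x \<bullet> y) = \<mu> * (x \<bullet> y)"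
      using sa[of x y] by simp
    then show ?thesis using that(3) by (simp add: orthogonal_def)
  qed
  have disj: "B \<kappa> \<inter> B \<mu> = {}" if "\<kappa> \<noteq> \<mu>" for \<kappa> \<mu>
  proof -
    have "x = 0" if "x \<in> B \<kappa>" "x \<in> B \<mu>" for x
      using orth[OF that \<open>\<kappa> \<noteq> \<mu>\<close>] by (simp add: orthogonal_self)
    then show ?thesis using B(3) by blast
  qed
  have "independent (\<Union>\<kappa>\<in>K. B \<kappa>)"
  proof (rule pairwise_orthogonal_independent)
    show "pairwise orthogonal (\<Union>\<kappa>\<in>K. B \<kappa>)"
      using orth B(2) unfolding pairwise_def by (metis UN_E)
  qed (use B(3) in blast)
  moreover have "(\<Union>\<kappa>\<in>K. B \<kappa>) \<subseteq> W" using B(1) by (force simp: E_def)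
  ultimately have "card (\<Union>\<kappa>\<in>K. B \<kappa>) \<le> dim W"
    by (rule independent_card_le_dim[rotated])
  moreover have "card (\<Union>\<kappa>\<in>K. B \<kappa>) = (\<Sum>\<kappa>\<in>K. card (B \<kappa>))"
    using assms(3) B(4) disj by (intro card_UN_disjoint) auto
  ultimately show ?thesis by (simp add: B(5) E_def)
qed

lemma finite_eigenvalues:
  fixes f :: "'a::euclidean_space \<Rightarrow> 'a"
  assumes "linear f" "subspace W"
    and sa: "\<And>x y. x \<in> W \<Longrightarrow> y \<in> W \<Longrightarrow> f x \<bullet> y = x \<bullet> f y"
  shows "finite {\<kappa>. \<exists>v\<in>{v \<in> W. f v = \<kappa> *\<^sub>R v}. v \<noteq> 0}"
proof -
  let ?E = "\<lambda>\<kappa>. {v \<in> W. f v = \<kappa> *\<^sub>R v}"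
  have "card G \<le> dim W" if G: "G \<subseteq> {\<kappa>. \<exists>v\<in>?E \<kappa>. v \<noteq> 0}" "finite G" for G
  proof -
    have "card G = (\<Sum>\<kappa>\<in>G. 1)" by simp
    also have "\<dots> \<le> (\<Sum>\<kappa>\<in>G. dim (?E \<kappa>))"
    proof (rule sum_mono)
      fix \<kappa> assume "\<kappa> \<in> G"
      then have "\<not> ?E \<kappa> \<subseteq> {0}" using G(1) by auto
      then have "dim (?E \<kappa>) \<noteq> 0" unfolding dim_eq_0 .
      then show "1 \<le> dim (?E \<kappa>)" by linarith
    qed
    also have "\<dots> \<le> dim W"
      by (rule sum_dim_eigenspaces_le[OF assms(1,2) G(2) sa])
    finally show ?thesis .
  qed
  then show ?thesis
    using finite_if_finite_subsets_card_bdd by blast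
qed

section \<open>Patches of hypersurfaces of the sphere\<close>

lemma linear_axis_expansion:
  fixes L :: "real^'n \<Rightarrow> 'b::real_vector"
  assumes "linear L"
  shows "L w = (\<Sum>i\<in>UNIV. (w $ i) *\<^sub>R L (axis i 1))"
proof -
  interpret linear L by fact
  have "L w = L (\<Sum>i\<in>UNIV. (w $ i) *\<^sub>R axis i 1)"
    by (simp add: basis_expansion flip: scalar_mult_eq_scaleR)
  also have "\<dots> = (\<Sum>i\<in>UNIV. (w $ i) *\<^sub>R L (axis i 1))"
    by (simp add: sum scale)
  finally show ?thesis .
qed

text \<open>
  A parametrization \<open>\<phi>\<close> of a piece of a hypersurface of the unit sphere, together with its unit normal
  \<open>N\<close> as a function of the coordinates. The plane spanned by \<open>\<phi> u\<close> and \<open>N u\<close> is the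
  orthogonal complement of the tangent space in the ambient space.
\<close>
locale sphere_patch =
  fixes U :: "(real^'n::finite) set" and \<phi> N :: "real^'n \<Rightarrow> 'a::euclidean_space"
  assumes DIM_ambient: "DIM('a) = CARD('n) + 2"
    and open_U: "open U"
    and smooth_\<phi>: "smooth_map U \<phi>"
    and smooth_N: "smooth_map U N"
    and immersion: "u \<in> U \<Longrightarrow> inj (\<lambda>w. \<partial>\<^bsub>w\<^esub> \<phi> u)"
    and \<phi>_\<phi>: "u \<in> U \<Longrightarrow> \<phi> u \<bullet> \<phi> u = 1"
    and N_N: "u \<in> U \<Longrightarrow> N u \<bullet> N u = 1"
    and N_\<phi>: "u \<in> U \<Longrightarrow> N u \<bullet> \<phi> u = 0"
    and N_d\<phi>: "u \<in> U \<Longrightarrow> N u \<bullet> \<partial>\<^bsub>w\<^esub> \<phi> u = 0"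
begin

lemmas smooths = smooth_\<phi> smooth_N smooth_map_dir_deriv smooth_map_inner[OF open_U]
  smooth_map_mult[OF open_U] smooth_map_scaleR[OF open_U] smooth_map_sum[OF open_U]

lemma patch_differentiable [simp]:
  "u \<in> U \<Longrightarrow> \<phi> differentiable at u" "u \<in> U \<Longrightarrow> N differentiable at u"
  "u \<in> U \<Longrightarrow> \<partial>\<^bsub>w\<^esub> \<phi> differentiable at u" "u \<in> U \<Longrightarrow> \<partial>\<^bsub>w\<^esub> N differentiable at u"
  "u \<in> U \<Longrightarrow> \<partial>\<^bsub>v\<^esub> (\<partial>\<^bsub>w\<^esub> \<phi>) differentiable at u"
  by (auto intro!: smooth_map_differentiable[where U = U] smooths)

lemma linear_d\<phi>: "u \<in> U \<Longrightarrow> linear (\<lambda>w. \<partial>\<^bsub>w\<^esub> \<phi> u)"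
  and linear_dN: "u \<in> U \<Longrightarrow> linear (\<lambda>w. \<partial>\<^bsub>w\<^esub> N u)"
  by (simp_all add: linear_dir_deriv)

lemma \<phi>_d\<phi>: "u \<in> U \<Longrightarrow> \<phi> u \<bullet> \<partial>\<^bsub>w\<^esub> \<phi> u = 0"
  using dir_deriv_zero[of U u "\<lambda>u. \<phi> u \<bullet> \<phi> u" 1 w] open_U \<phi>_\<phi>
  by (simp add: dir_deriv_inner inner_commute)

lemma N_dN: "u \<in> U \<Longrightarrow> N u \<bullet> \<partial>\<^bsub>w\<^esub> N u = 0"
  using dir_deriv_zero[of U u "\<lambda>u. N u \<bullet> N u" 1 w] open_U N_N
  by (simp add: dir_deriv_inner inner_commute)

lemma \<phi>_dN: "u \<in> U \<Longrightarrow> \<phi> u \<bullet> \<partial>\<^bsub>w\<^esub> N u = 0"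
  using dir_deriv_zero[of U u "\<lambda>u. N u \<bullet> \<phi> u" 0 w] open_U N_\<phi>
  by (simp add: dir_deriv_inner inner_commute N_d\<phi>)

lemma dd\<phi>_\<phi>: "u \<in> U \<Longrightarrow> \<partial>\<^bsub>v\<^esub> (\<partial>\<^bsub>w\<^esub> \<phi>) u \<bullet> \<phi> u = - (\<partial>\<^bsub>v\<^esub> \<phi> u \<bullet> \<partial>\<^bsub>w\<^esub> \<phi> u)"
  using dir_deriv_zero[of U u "\<lambda>u. \<phi> u \<bullet> \<partial>\<^bsub>w\<^esub> \<phi> u" 0 v] open_U \<phi>_d\<phi>
  by (simp add: dir_deriv_inner inner_commute)

lemma dd\<phi>_N: "u \<in> U \<Longrightarrow> \<partial>\<^bsub>v\<^esub> (\<partial>\<^bsub>w\<^esub> \<phi>) u \<bullet> N u = - (\<partial>\<^bsub>v\<^esub> N u \<bullet> \<partial>\<^bsub>w\<^esub> \<phi> u)"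
  using dir_deriv_zero[of U u "\<lambda>u. N u \<bullet> \<partial>\<^bsub>w\<^esub> \<phi> u" 0 v] open_U N_d\<phi>
  by (simp add: dir_deriv_inner inner_commute)

lemma dd\<phi>_commute: "u \<in> U \<Longrightarrow> \<partial>\<^bsub>v\<^esub> (\<partial>\<^bsub>w\<^esub> \<phi>) u = \<partial>\<^bsub>w\<^esub> (\<partial>\<^bsub>v\<^esub> \<phi>) u"
  by (rule dir_deriv_commute[OF open_U smooth_\<phi>])

lemma dN_d\<phi>_commute: "u \<in> U \<Longrightarrow> \<partial>\<^bsub>v\<^esub> N u \<bullet> \<partial>\<^bsub>w\<^esub> \<phi> u = \<partial>\<^bsub>w\<^esub> N u \<bullet> \<partial>\<^bsub>v\<^esub> \<phi> u"
  using dd\<phi>_N[of u v w] dd\<phi>_N[of u w v] dd\<phi>_commute[of u v w] by simp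

text \<open>
  The inclusion is clear from the orthogonality relations; both spaces have dimension \<open>n\<close>.
\<close>
lemma range_d\<phi>:
  assumes "u \<in> U"
  shows "range (\<lambda>w. \<partial>\<^bsub>w\<^esub> \<phi> u) = {v. v \<bullet> \<phi> u = 0 \<and> v \<bullet> N u = 0}"
proof -
  let ?W = "{v. v \<bullet> \<phi> u = 0 \<and> v \<bullet> N u = 0}"
  have "independent {\<phi> u, N u}"
    using assms \<phi>_\<phi>[of u] N_N[of u] N_\<phi>[of u]
    by (intro pairwise_orthogonal_independent)
       (auto simp: pairwise_insert orthogonal_def inner_commute)
  moreover have "\<phi> u \<noteq> N u"
    using \<phi>_\<phi>[OF assms] N_\<phi>[OF assms] by auto
  ultimately have "dim (span {\<phi> u, N u}) = 2"
    by (simp add: dim_eq_card_independent)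
  moreover have "dim {y \<in> UNIV. \<forall>x\<in>span {\<phi> u, N u}. orthogonal x y} + dim (span {\<phi> u, N u})
      = dim (UNIV :: 'a set)"
    by (rule dim_subspace_orthogonal_to_vectors) auto
  moreover have "{y \<in> UNIV. \<forall>x\<in>span {\<phi> u, N u}. orthogonal x y} = ?W"
  proof -
    have "(\<forall>x\<in>span {\<phi> u, N u}. orthogonal x y) \<longleftrightarrow> y \<in> ?W" for y
    proof
      assume "\<forall>x\<in>span {\<phi> u, N u}. orthogonal x y"
      then have "orthogonal (\<phi> u) y" "orthogonal (N u) y"
        by (simp_all add: span_base)
      then show "y \<in> ?W" by (simp add: orthogonal_def inner_commute)
    next
      assume "y \<in> ?W"
      then have "orthogonal y z" if "z \<in> {\<phi> u, N u}" for z
        using that by (auto simp: orthogonal_def)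
      then show "\<forall>x\<in>span {\<phi> u, N u}. orthogonal x y"
        using orthogonal_to_span[of _ "{\<phi> u, N u}" y] by (simp add: orthogonal_commute)
    qed
    then show ?thesis by simp
  qed
  ultimately have dimW: "dim ?W = CARD('n)"
    using DIM_ambient by simp
  have dimR: "dim (range (\<lambda>w. \<partial>\<^bsub>w\<^esub> \<phi> u)) = CARD('n)"
    using dim_image_eq[OF linear_d\<phi>[OF assms], of UNIV] immersion[OF assms] by simp
  show ?thesis
  proof (rule subspace_dim_equal)
    show "subspace (range (\<lambda>w. \<partial>\<^bsub>w\<^esub> \<phi> u))"
      by (rule linear_subspace_image[OF linear_d\<phi>[OF assms] subspace_UNIV])
    show "subspace ?W"
      by (auto simp: subspace_def inner_add_left)
    show "range (\<lambda>w. \<partial>\<^bsub>w\<^esub> \<phi> u) \<subseteq> ?W"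
      using \<phi>_d\<phi>[OF assms] N_d\<phi>[OF assms] by (auto simp: inner_commute)
  qed (simp add: dimW dimR)
qed

abbreviation e :: "'n \<Rightarrow> real^'n \<Rightarrow> 'a" where
  "e i \<equiv> \<partial>\<^bsub>axis i 1\<^esub> \<phi>"

abbreviation g :: "real^'n \<Rightarrow> real^'n^'n" where
  "g \<equiv> induced_metric \<phi>"

lemma g_nth: "g u $ i $ j = e i u \<bullet> e j u"
  by (simp add: induced_metric_def dir_deriv_def)

lemma invertible_g:
  assumes "u \<in> U"
  shows "invertible (g u)"
proof -
  have "x = 0" if "g u *v x = 0" for x
  proof -
    have "\<partial>\<^bsub>x\<^esub> \<phi> u \<bullet> \<partial>\<^bsub>x\<^esub> \<phi> u = x \<bullet> (g u *v x)"
      unfolding linear_axis_expansion[OF linear_d\<phi>[OF assms], of x]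
      by (simp add: inner_sum_left inner_sum_right inner_vec_def matrix_vector_mult_def g_nth
          sum_distrib_left mult_ac inner_commute)
    then have "\<partial>\<^bsub>x\<^esub> \<phi> u = \<partial>\<^bsub>0\<^esub> \<phi> u"
      using that linear_0[OF linear_d\<phi>[OF assms]] by simp
    then show ?thesis
      using injD[OF immersion[OF assms]] by blast
  qed
  then have "inj ((*v) (g u))"
    by (simp add: linear_injective_0[OF matrix_vector_mul_linear])
  then show ?thesis
    by (simp add: invertible_left_inverse matrix_left_invertible_injective)
qed

text \<open>
  The dual frame: the tangent vectors with \<open>\<omega>\<^sub>l \<bullet> e\<^sub>k = \<delta>\<^sub>l\<^sub>k\<close>, obtained by
  raising the index of \<open>e\<close>. Coefficients in the coordinate frame are inner products with \<open>\<omega>\<close>.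
\<close>
definition \<omega> :: "'n \<Rightarrow> real^'n \<Rightarrow> 'a" where
  "\<omega> l u = (\<Sum>m\<in>UNIV. matrix_inv (g u) $ l $ m *\<^sub>R e m u)"

lemma smooth_\<omega>: "smooth_map U (\<omega> l)"
  unfolding \<omega>_def
  by (intro smooths smooth_map_matrix_inv[OF open_U _ invertible_g]) (simp_all add: g_nth smooths)

lemma \<omega>_differentiable [simp]: "u \<in> U \<Longrightarrow> \<omega> l differentiable at u"
  by (rule smooth_map_differentiable[OF smooth_\<omega>])

lemma \<omega>_e: 
  assumes "u \<in> U"
  shows "\<omega> l u \<bullet> e k u = (if l = k then 1 else 0)"
proof -
  have "\<omega> l u \<bullet> e k u = (matrix_inv (g u) ** g u) $ l $ k"
    by (simp add: \<omega>_def inner_sum_left g_nth matrix_matrix_mult_def)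
  then show ?thesis
    using matrix_inv_works(2)[OF invertible_g[OF assms]] by (simp add: mat_def)
qed

lemma \<omega>_\<phi>: "u \<in> U \<Longrightarrow> \<omega> l u \<bullet> \<phi> u = 0" and \<omega>_N: "u \<in> U \<Longrightarrow> \<omega> l u \<bullet> N u = 0"
  by (simp_all add: \<omega>_def inner_sum_left \<phi>_d\<phi> N_d\<phi> inner_commute[of "e _ u"])

lemma tangent_expansion:
  assumes "u \<in> U" "v \<bullet> \<phi> u = 0" "v \<bullet> N u = 0"
  shows "v = (\<Sum>i\<in>UNIV. (v \<bullet> \<omega> i u) *\<^sub>R e i u)"
proof -
  have "v \<in> range (\<lambda>w. \<partial>\<^bsub>w\<^esub> \<phi> u)"
    using range_d\<phi>[OF assms(1)] assms(2,3) by blast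
  then obtain w where w: "v = \<partial>\<^bsub>w\<^esub> \<phi> u" by blast
  have exp: "v = (\<Sum>i\<in>UNIV. w $ i *\<^sub>R e i u)"
    unfolding w by (rule linear_axis_expansion[OF linear_d\<phi>[OF assms(1)]])
  have "v \<bullet> \<omega> i u = w $ i" for i
    unfolding exp
    by (simp add: inner_sum_left inner_commute[of "e _ u"] \<omega>_e[OF assms(1)] if_distrib cong: if_cong)
  then show ?thesis using exp by simp
qed

lemma ambient_expansion:
  assumes "u \<in> U"
  shows "v = (\<Sum>i\<in>UNIV. (v \<bullet> \<omega> i u) *\<^sub>R e i u) + (v \<bullet> \<phi> u) *\<^sub>R \<phi> u + (v \<bullet> N u) *\<^sub>R N u"
proof -
  define t where "t = v - (v \<bullet> \<phi> u) *\<^sub>R \<phi> u - (v \<bullet> N u) *\<^sub>R N u"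
  have "t \<bullet> \<phi> u = 0" "t \<bullet> N u = 0"
    using \<phi>_\<phi>[OF assms] N_N[OF assms] N_\<phi>[OF assms]
    by (simp_all add: t_def inner_diff_left inner_commute[of "\<phi> u" "N u"])
  then have "t = (\<Sum>i\<in>UNIV. (t \<bullet> \<omega> i u) *\<^sub>R e i u)"
    by (rule tangent_expansion[OF assms])
  moreover have "t \<bullet> \<omega> i u = v \<bullet> \<omega> i u" for i
    using \<omega>_\<phi>[OF assms] \<omega>_N[OF assms]
    by (simp add: t_def inner_diff_left inner_commute[of "\<phi> u"] inner_commute[of "N u"])
  ultimately have "t = (\<Sum>i\<in>UNIV. (v \<bullet> \<omega> i u) *\<^sub>R e i u)"
    by simp
  moreover have "v = t + (v \<bullet> \<phi> u) *\<^sub>R \<phi> u + (v \<bullet> N u) *\<^sub>R N u"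
    by (simp add: t_def)
  ultimately show ?thesis
    by simp
qed

section \<open>The Gauss equation and its traces\<close>

lemma christoffel_eq:
  assumes "u \<in> U"
  shows "christoffel g k i j u = \<partial>\<^bsub>axis i 1\<^esub> (e j) u \<bullet> \<omega> k u"
proof -
  have "pderiv_at i (\<lambda>w. g w $ j $ l) u
      = \<partial>\<^bsub>axis i 1\<^esub> (e j) u \<bullet> e l u + e j u \<bullet> \<partial>\<^bsub>axis i 1\<^esub> (e l) u" for i j l
    unfolding pderiv_at_def g_nth dir_deriv_def[symmetric, THEN fun_cong]
    using assms by (simp add: dir_deriv_inner)
  then have "pderiv_at i (\<lambda>w. g w $ j $ l) u + pderiv_at j (\<lambda>w. g w $ i $ l) u
      - pderiv_at l (\<lambda>w. g w $ i $ j) u = 2 * (\<partial>\<^bsub>axis i 1\<^esub> (e j) u \<bullet> e l u)" for l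
    using dd\<phi>_commute[OF assms, of "axis j 1" "axis i 1"]
      dd\<phi>_commute[OF assms, of "axis l 1" "axis i 1"]
      dd\<phi>_commute[OF assms, of "axis l 1" "axis j 1"]
    by (simp add: inner_commute)
  then show ?thesis
    by (simp add: christoffel_def \<omega>_def inner_sum_right sum_distrib_left)
qed

text \<open>
  By \<open>christoffel_eq\<close> the symbol \<open>\<Gamma>\<^sup>l\<^sub>j\<^sub>k\<close> is
  \<open>\<partial>\<^sub>j e\<^sub>k \<bullet> \<omega>\<^sub>l\<close>. In \<open>\<partial>\<^sub>i \<Gamma>\<^sup>l\<^sub>j\<^sub>k - \<partial>\<^sub>j \<Gamma>\<^sup>l\<^sub>i\<^sub>k\<close> the third
  derivatives of \<open>\<phi>\<close> cancel, and what is left is \<open>\<partial>\<^sub>j e\<^sub>k \<bullet> \<partial>\<^sub>i \<omega>\<^sub>l\<close>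
  antisymmetrized. The tangential part of \<open>\<partial>\<^sub>j e\<^sub>k\<close> cancels the quadratic terms in
  \<open>\<Gamma>\<close>, its component along \<open>\<phi>\<close> gives the curvature of the sphere, and its component along \<open>N\<close> the
  second fundamental form.
\<close>
lemma gauss_equation:
  assumes "u \<in> U"
  shows "riemann g l k i j u =
      (e j u \<bullet> e k u) * (e i u \<bullet> \<omega> l u) - (e i u \<bullet> e k u) * (e j u \<bullet> \<omega> l u)
    + (\<partial>\<^bsub>axis j 1\<^esub> N u \<bullet> e k u) * (\<partial>\<^bsub>axis i 1\<^esub> N u \<bullet> \<omega> l u)
    - (\<partial>\<^bsub>axis i 1\<^esub> N u \<bullet> e k u) * (\<partial>\<^bsub>axis j 1\<^esub> N u \<bullet> \<omega> l u)"
proof -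
  let ?G = "\<lambda>k i j. \<partial>\<^bsub>axis i 1\<^esub> (e j) u \<bullet> \<omega> k u"
  have d: "pderiv_at i (christoffel g l j k) u
      = \<partial>\<^bsub>axis i 1\<^esub> (\<partial>\<^bsub>axis j 1\<^esub> (e k)) u \<bullet> \<omega> l u + \<partial>\<^bsub>axis j 1\<^esub> (e k) u \<bullet> \<partial>\<^bsub>axis i 1\<^esub> (\<omega> l) u" for i j
  proof -
    have "pderiv_at i (christoffel g l j k) u = \<partial>\<^bsub>axis i 1\<^esub> (christoffel g l j k) u"
      by (simp add: pderiv_at_def dir_deriv_def)
    also have "\<dots> = \<partial>\<^bsub>axis i 1\<^esub> (\<lambda>u. \<partial>\<^bsub>axis j 1\<^esub> (e k) u \<bullet> \<omega> l u) u"
      by (rule dir_deriv_cong[OF open_U assms, symmetric])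
         (use assms in \<open>simp_all add: christoffel_eq\<close>)
    finally show ?thesis
      using assms by (simp add: dir_deriv_inner)
  qed
  have "e m u \<bullet> \<partial>\<^bsub>axis i 1\<^esub> (\<omega> l) u = - ?G l i m" for i m
    using dir_deriv_zero[of U u "\<lambda>u. \<omega> l u \<bullet> e m u" "if l = m then 1 else 0" "axis i 1"] open_U \<omega>_e assms
    by (simp add: dir_deriv_inner inner_commute)
  moreover have "\<phi> u \<bullet> \<partial>\<^bsub>axis i 1\<^esub> (\<omega> l) u = - (e i u \<bullet> \<omega> l u)" for i
    using dir_deriv_zero[of U u "\<lambda>u. \<omega> l u \<bullet> \<phi> u" 0 "axis i 1"] open_U \<omega>_\<phi> assms
    by (simp add: dir_deriv_inner inner_commute)
  moreover have "N u \<bullet> \<partial>\<^bsub>axis i 1\<^esub> (\<omega> l) u = - (\<partial>\<^bsub>axis i 1\<^esub> N u \<bullet> \<omega> l u)" for i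
    using dir_deriv_zero[of U u "\<lambda>u. \<omega> l u \<bullet> N u" 0 "axis i 1"] open_U \<omega>_N assms
    by (simp add: dir_deriv_inner inner_commute)
  ultimately have second: "\<partial>\<^bsub>axis j 1\<^esub> (e k) u \<bullet> \<partial>\<^bsub>axis i 1\<^esub> (\<omega> l) u
      = - (\<Sum>m\<in>UNIV. ?G m j k * ?G l i m) + (e j u \<bullet> e k u) * (e i u \<bullet> \<omega> l u)
        + (\<partial>\<^bsub>axis j 1\<^esub> N u \<bullet> e k u) * (\<partial>\<^bsub>axis i 1\<^esub> N u \<bullet> \<omega> l u)" for i j
    by (subst ambient_expansion[OF assms, of "\<partial>\<^bsub>axis j 1\<^esub> (e k) u"])
       (simp add: inner_add_left inner_diff_left inner_sum_left dd\<phi>_\<phi>[OF assms] dd\<phi>_N[OF assms] sum_negf)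
  have third: "\<partial>\<^bsub>axis i 1\<^esub> (\<partial>\<^bsub>axis j 1\<^esub> (e k)) u = \<partial>\<^bsub>axis j 1\<^esub> (\<partial>\<^bsub>axis i 1\<^esub> (e k)) u"
    by (rule dir_deriv_commute[OF open_U smooth_map_dir_deriv[OF smooth_\<phi>] assms])
  show ?thesis
    unfolding riemann_def d second third
    by (simp add: christoffel_eq[OF assms] sum_subtractf mult.commute)
qed

lemma ricci_eq:
  assumes "u \<in> U"
  shows "ricci g j k u = (real CARD('n) - 1) * (e j u \<bullet> e k u)
    + (\<partial>\<^bsub>axis j 1\<^esub> N u \<bullet> e k u) * (\<Sum>i\<in>UNIV. \<partial>\<^bsub>axis i 1\<^esub> N u \<bullet> \<omega> i u)
    - \<partial>\<^bsub>axis j 1\<^esub> N u \<bullet> \<partial>\<^bsub>axis k 1\<^esub> N u"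
proof -
  have 1: "(\<Sum>i\<in>UNIV. (e j u \<bullet> e k u) * (e i u \<bullet> \<omega> i u)) = CARD('n) * (e j u \<bullet> e k u)"
    by (simp add: inner_commute[of _ "\<omega> _ u"] \<omega>_e[OF assms])
  have 2: "(\<Sum>i\<in>UNIV. (e i u \<bullet> e k u) * (e j u \<bullet> \<omega> i u)) = e j u \<bullet> e k u"
    by (simp add: inner_commute[of "e j u" "\<omega> _ u"] \<omega>_e[OF assms] if_distrib cong: if_cong)
  have 3: "(\<Sum>i\<in>UNIV. (\<partial>\<^bsub>axis i 1\<^esub> N u \<bullet> e k u) * (\<partial>\<^bsub>axis j 1\<^esub> N u \<bullet> \<omega> i u))
      = \<partial>\<^bsub>axis j 1\<^esub> N u \<bullet> \<partial>\<^bsub>axis k 1\<^esub> N u"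
  proof -
    have "\<partial>\<^bsub>axis j 1\<^esub> N u = (\<Sum>i\<in>UNIV. (\<partial>\<^bsub>axis j 1\<^esub> N u \<bullet> \<omega> i u) *\<^sub>R e i u)"
      using tangent_expansion[OF assms, of "\<partial>\<^bsub>axis j 1\<^esub> N u"] \<phi>_dN[OF assms] N_dN[OF assms]
      by (simp add: inner_commute)
    then have "\<partial>\<^bsub>axis j 1\<^esub> N u \<bullet> \<partial>\<^bsub>axis k 1\<^esub> N u
        = (\<Sum>i\<in>UNIV. (\<partial>\<^bsub>axis j 1\<^esub> N u \<bullet> \<omega> i u) *\<^sub>R e i u) \<bullet> \<partial>\<^bsub>axis k 1\<^esub> N u"
      by simp
    also have "\<dots> = (\<Sum>i\<in>UNIV. (\<partial>\<^bsub>axis i 1\<^esub> N u \<bullet> e k u) * (\<partial>\<^bsub>axis j 1\<^esub> N u \<bullet> \<omega> i u))"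
      by (simp add: inner_sum_left inner_commute[of "e _ u"] dN_d\<phi>_commute[OF assms, of "axis k 1"] mult.commute)
    finally show ?thesis by simp
  qed
  show ?thesis
    unfolding ricci_def gauss_equation[OF assms] sum.distrib sum_subtractf 1 2 3
    by (simp add: sum_distrib_left left_diff_distrib)
qed

section \<open>The extended shape operator\<close>

text \<open>
  The shape operator in terms of the coordinates of its base point, extended by zero on the normal
  plane: \<open>T\<close> sends \<open>e\<^sub>j\<close> to \<open>- \<partial>\<^sub>j N\<close> and kills \<open>\<phi>\<close> and \<open>N\<close>. The
  extension is self-adjoint on the whole ambient space.
\<close>
definition T :: "real^'n \<Rightarrow> 'a \<Rightarrow>\<^sub>L 'a" where
  "T u = - (\<Sum>j\<in>UNIV. blinfun_scaleR_left (\<partial>\<^bsub>axis j 1\<^esub> N u) o\<^sub>L blinfun_inner_left (\<omega> j u))"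

lemma T_apply: "T u v = - (\<Sum>j\<in>UNIV. (v \<bullet> \<omega> j u) *\<^sub>R \<partial>\<^bsub>axis j 1\<^esub> N u)"
  by (simp add: T_def blinfun.minus_left blinfun.sum_left)

lemma smooth_T: "smooth_map U T"
  unfolding T_def
  by (intro smooth_map_uminus smooth_map_sum smooth_map_blinfun_compose open_U smooth_\<omega> smooths
    smooth_map_linear[OF open_U bounded_linear_blinfun_scaleR_left]
    smooth_map_linear[OF open_U bounded_linear_blinfun_inner_left])

lemma T_d\<phi>:
  assumes "u \<in> U"
  shows "T u (\<partial>\<^bsub>w\<^esub> \<phi> u) = - \<partial>\<^bsub>w\<^esub> N u"
proof -
  have "\<partial>\<^bsub>w\<^esub> \<phi> u \<bullet> \<omega> j u = w $ j" for j
    unfolding linear_axis_expansion[OF linear_d\<phi>[OF assms], of w]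
    by (simp add: inner_sum_left inner_commute[of "e _ u"] \<omega>_e[OF assms] if_distrib cong: if_cong)
  then show ?thesis
    unfolding T_apply linear_axis_expansion[OF linear_dN[OF assms], of w] by simp
qed

lemma T_\<phi>: "u \<in> U \<Longrightarrow> T u (\<phi> u) = 0" and T_N: "u \<in> U \<Longrightarrow> T u (N u) = 0"
  by (simp_all add: T_apply inner_commute[of _ "\<omega> _ u"] \<omega>_\<phi> \<omega>_N)

lemma T_tangent:
  "u \<in> U \<Longrightarrow> T u v \<bullet> \<phi> u = 0" "u \<in> U \<Longrightarrow> T u v \<bullet> N u = 0"
  by (simp_all add: T_apply inner_sum_left inner_commute[of "\<partial>\<^bsub>_\<^esub> N u"] \<phi>_dN N_dN)

lemma T_self_adjoint:
  assumes "u \<in> U"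
  shows "T u v \<bullet> w = v \<bullet> T u w"
proof -
  define t where "t v = v - (v \<bullet> \<phi> u) *\<^sub>R \<phi> u - (v \<bullet> N u) *\<^sub>R N u" for v
  have "\<exists>x. t v = \<partial>\<^bsub>x\<^esub> \<phi> u" for v
  proof -
    have "t v \<bullet> \<phi> u = 0" "t v \<bullet> N u = 0"
      using \<phi>_\<phi>[OF assms] N_N[OF assms] N_\<phi>[OF assms]
      by (simp_all add: t_def inner_diff_left inner_commute[of "\<phi> u" "N u"])
    then show ?thesis using range_d\<phi>[OF assms] by blast
  qed
  then obtain x where x: "\<And>v. t v = \<partial>\<^bsub>x v\<^esub> \<phi> u" by metis
  have Tt: "T u v = T u (t v)" for v
    by (simp add: t_def blinfun.diff_right blinfun.scaleR_right T_\<phi>[OF assms] T_N[OF assms])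
  have "T u v \<bullet> w = T u v \<bullet> t w" for v w
    using T_tangent[OF assms, of v] by (simp add: t_def inner_diff_right)
  then have "T u v \<bullet> w = T u (t v) \<bullet> t w" for v w
    using Tt[of v] by simp
  then have "T u v \<bullet> w = - (\<partial>\<^bsub>x v\<^esub> N u \<bullet> \<partial>\<^bsub>x w\<^esub> \<phi> u)" for v w
    by (simp add: x T_d\<phi>[OF assms])
  then show ?thesis
    using dN_d\<phi>_commute[OF assms] by (metis inner_commute)
qed

section \<open>The scalar curvature in terms of the eigenvalues\<close>

text \<open>
  Both sides are the trace of the tangential part of \<open>f\<close> on the tangent space: expand \<open>b\<close> in the
  coordinate frame, exchange the sums, and collect the expansion of \<open>\<omega>\<^sub>j\<close> in \<open>B\<close>.
\<close>
lemma trace_dual_frame: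
  assumes "u \<in> U" and B: "finite B" "pairwise orthogonal B" "\<And>b. b \<in> B \<Longrightarrow> norm b = 1"
    "span B = range (\<lambda>w. \<partial>\<^bsub>w\<^esub> \<phi> u)" and "linear f"
  shows "(\<Sum>j\<in>UNIV. f (e j u) \<bullet> \<omega> j u) = (\<Sum>b\<in>B. f b \<bullet> b)"
proof -
  interpret f: linear f by fact
  have exp: "(\<Sum>b\<in>B. (\<omega> j u \<bullet> b) *\<^sub>R b) = \<omega> j u" for j
  proof -
    have "\<omega> j u \<in> range (\<lambda>w. \<partial>\<^bsub>w\<^esub> \<phi> u)"
      unfolding range_d\<phi>[OF assms(1)] using \<omega>_\<phi> \<omega>_N assms(1) by simp
    with B show ?thesis
      by (intro orthonormal_basis_expand) auto
  qed
  have "f b = (\<Sum>j\<in>UNIV. (b \<bullet> \<omega> j u) *\<^sub>R f (e j u))" if "b \<in> B" for b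
  proof -
    have "b \<in> range (\<lambda>w. \<partial>\<^bsub>w\<^esub> \<phi> u)"
      using B(4) span_base[OF that] by auto
    then have "b \<bullet> \<phi> u = 0" "b \<bullet> N u = 0"
      using range_d\<phi>[OF assms(1)] by auto
    from tangent_expansion[OF assms(1) this] show ?thesis
      by (metis (no_types, lifting) f.sum f.scale sum.cong)
  qed
  then have "(\<Sum>b\<in>B. f b \<bullet> b) = (\<Sum>b\<in>B. \<Sum>j\<in>UNIV. (b \<bullet> \<omega> j u) * (f (e j u) \<bullet> b))"
    by (intro sum.cong) (simp_all add: inner_sum_left)
  also have "\<dots> = (\<Sum>j\<in>UNIV. \<Sum>b\<in>B. (b \<bullet> \<omega> j u) * (f (e j u) \<bullet> b))"
    by (rule sum.swap)
  also have "\<dots> = (\<Sum>j\<in>UNIV. f (e j u) \<bullet> (\<Sum>b\<in>B. (\<omega> j u \<bullet> b) *\<^sub>R b))"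
    by (simp add: inner_sum_right inner_commute)
  also have "\<dots> = (\<Sum>j\<in>UNIV. f (e j u) \<bullet> \<omega> j u)"
    by (simp only: exp)
  finally show ?thesis by simp
qed

lemma scalar_curvature_eq_eigenvalues:
  assumes "u \<in> U" and B: "finite B" "pairwise orthogonal B" "\<And>b. b \<in> B \<Longrightarrow> norm b = 1"
    "span B = range (\<lambda>w. \<partial>\<^bsub>w\<^esub> \<phi> u)" and lam: "\<And>b. b \<in> B \<Longrightarrow> T u b = lam b *\<^sub>R b"
  shows "scalar_curvature g u
    = real CARD('n) * (real CARD('n) - 1) + (\<Sum>b\<in>B. lam b)\<^sup>2 - (\<Sum>b\<in>B. (lam b)\<^sup>2)"
proof -
  note tr = trace_dual_frame[OF assms(1) B]
  have N_T: "\<partial>\<^bsub>w\<^esub> N u = - T u (\<partial>\<^bsub>w\<^esub> \<phi> u)" for w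
    by (simp add: T_d\<phi>[OF assms(1)])
  define H where "H = (\<Sum>i\<in>UNIV. \<partial>\<^bsub>axis i 1\<^esub> N u \<bullet> \<omega> i u)"
  have bb: "b \<bullet> b = 1" if "b \<in> B" for b
    using B(3)[OF that] by (simp add: dot_square_norm)
  have H: "H = - (\<Sum>b\<in>B. lam b)"
  proof -
    have "(\<Sum>i\<in>UNIV. T u (e i u) \<bullet> \<omega> i u) = (\<Sum>b\<in>B. T u b \<bullet> b)"
      by (rule tr) (auto intro: bounded_linear.linear[OF blinfun.bounded_linear_right])
    also have "\<dots> = (\<Sum>b\<in>B. lam b)"
      by (intro sum.cong) (simp_all add: lam bb)
    finally show ?thesis by (simp add: H_def N_T sum_negf)
  qed
  have "(\<Sum>j\<in>UNIV. T u (T u (e j u)) \<bullet> \<omega> j u) = (\<Sum>b\<in>B. T u (T u b) \<bullet> b)"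
    by (rule tr) (auto intro!: linearI simp: blinfun.add_right blinfun.scaleR_right)
  also have "\<dots> = (\<Sum>b\<in>B. (lam b)\<^sup>2)"
    by (intro sum.cong) (simp_all add: lam bb blinfun.scaleR_right power2_eq_square)
  finally have T2: "(\<Sum>j\<in>UNIV. T u (e j u) \<bullet> T u (\<omega> j u)) = (\<Sum>b\<in>B. (lam b)\<^sup>2)"
    by (simp add: T_self_adjoint[OF assms(1), of "T u _"])
  have "scalar_curvature g u = (\<Sum>j\<in>UNIV. (real CARD('n) - 1) * (e j u \<bullet> \<omega> j u)
      + (\<partial>\<^bsub>axis j 1\<^esub> N u \<bullet> \<omega> j u) * H - T u (e j u) \<bullet> T u (\<omega> j u))"
    unfolding scalar_curvature_def
  proof (rule sum.cong)
    fix j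
    have ric: "ricci g j k u = (real CARD('n) - 1) * (e j u \<bullet> e k u)
        + (\<partial>\<^bsub>axis j 1\<^esub> N u \<bullet> e k u) * H - T u (e j u) \<bullet> T u (e k u)" for k
      unfolding ricci_eq[OF assms(1)] H_def by (simp add: N_T)
    show "(\<Sum>k\<in>UNIV. matrix_inv (g u) $ j $ k * ricci g j k u)
      = (real CARD('n) - 1) * (e j u \<bullet> \<omega> j u)
        + (\<partial>\<^bsub>axis j 1\<^esub> N u \<bullet> \<omega> j u) * H - T u (e j u) \<bullet> T u (\<omega> j u)"
      unfolding ric
      by (simp add: \<omega>_def inner_sum_right blinfun.sum_right blinfun.scaleR_right sum_distrib_left
          sum_distrib_right sum.distrib sum_subtractf algebra_simps)
  qed simp
  also have "\<dots> = (real CARD('n) - 1) * real CARD('n) + H * H - (\<Sum>b\<in>B. (lam b)\<^sup>2)"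
    unfolding sum_subtractf sum.distrib T2
    by (simp add: inner_commute[of "e _ u"] \<omega>_e[OF assms(1)] flip: sum_distrib_right sum_distrib_left H_def)
  finally show ?thesis
    by (simp add: H power2_eq_square)
qed

section \<open>Derivatives of the extended shape operator\<close>

lemma T_differentiable [simp]:
  "u \<in> U \<Longrightarrow> T differentiable at u" "u \<in> U \<Longrightarrow> \<partial>\<^bsub>w\<^esub> T differentiable at u"
  by (auto intro!: smooth_map_differentiable[where U = U] smooth_map_dir_deriv smooth_T)

lemma dT_apply:
  assumes "u \<in> U" "x differentiable at u"
  shows "\<partial>\<^bsub>c\<^esub> (\<lambda>u. T u (x u)) u = T u (\<partial>\<^bsub>c\<^esub> x u) + \<partial>\<^bsub>c\<^esub> T u (x u)"
  using assms by (simp add: dir_deriv_blinfun_apply)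

lemma dT_const: "u \<in> U \<Longrightarrow> \<partial>\<^bsub>c\<^esub> (\<lambda>u. T u v) u = \<partial>\<^bsub>c\<^esub> T u v"
  by (simp add: dT_apply dir_deriv_const)

lemma ddT_const: "u \<in> U \<Longrightarrow> \<partial>\<^bsub>c\<^esub> (\<lambda>u. \<partial>\<^bsub>b\<^esub> T u v) u = \<partial>\<^bsub>c\<^esub> (\<partial>\<^bsub>b\<^esub> T) u v"
  by (simp add: dir_deriv_blinfun_apply dir_deriv_const)

lemma smooth_T_const: "smooth_map U (\<lambda>u. T u v)"
  by (intro smooth_map_blinfun_apply open_U smooth_T smooth_map_const)

lemma dT_self_adjoint:
  assumes "u \<in> U"
  shows "\<partial>\<^bsub>c\<^esub> T u v \<bullet> w = v \<bullet> \<partial>\<^bsub>c\<^esub> T u w"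
proof -
  have d: "(\<lambda>u. T u z) differentiable at u" for z
    by (rule smooth_map_differentiable[OF smooth_T_const assms])
  have "\<partial>\<^bsub>c\<^esub> (\<lambda>u. T u v \<bullet> w) u = \<partial>\<^bsub>c\<^esub> (\<lambda>u. v \<bullet> T u w) u"
    by (rule dir_deriv_cong[OF open_U assms]) (simp_all add: T_self_adjoint d)
  then show ?thesis
    by (simp add: dir_deriv_inner d dir_deriv_const dT_const assms)
qed

lemma ddT_self_adjoint:
  assumes "u \<in> U"
  shows "\<partial>\<^bsub>b\<^esub> (\<partial>\<^bsub>c\<^esub> T) u v \<bullet> w = v \<bullet> \<partial>\<^bsub>b\<^esub> (\<partial>\<^bsub>c\<^esub> T) u w"
proof -
  have d: "(\<lambda>u. \<partial>\<^bsub>c\<^esub> T u z) differentiable at u" for z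
    by (rule smooth_map_differentiable[OF smooth_map_blinfun_apply[OF open_U
          smooth_map_dir_deriv[OF smooth_T] smooth_map_const] assms])
  have "\<partial>\<^bsub>b\<^esub> (\<lambda>u. \<partial>\<^bsub>c\<^esub> T u v \<bullet> w) u = \<partial>\<^bsub>b\<^esub> (\<lambda>u. v \<bullet> \<partial>\<^bsub>c\<^esub> T u w) u"
    by (rule dir_deriv_cong[OF open_U assms]) (simp_all add: dT_self_adjoint d)
  then show ?thesis
    by (simp add: dir_deriv_inner d dir_deriv_const ddT_const assms)
qed

text \<open>
  Evaluating at a fixed vector turns the operator-valued function into a Euclidean one, for which mixed
  derivatives commute.
\<close>
lemma ddT_commute:
  assumes "u \<in> U"
  shows "\<partial>\<^bsub>b\<^esub> (\<partial>\<^bsub>c\<^esub> T) u v = \<partial>\<^bsub>c\<^esub> (\<partial>\<^bsub>b\<^esub> T) u v"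
proof -
  have "\<partial>\<^bsub>b\<^esub> (\<partial>\<^bsub>c\<^esub> T) u v = \<partial>\<^bsub>b\<^esub> (\<partial>\<^bsub>c\<^esub> (\<lambda>u. T u v)) u" for b c
  proof -
    have "\<partial>\<^bsub>b\<^esub> (\<partial>\<^bsub>c\<^esub> (\<lambda>u. T u v)) u = \<partial>\<^bsub>b\<^esub> (\<lambda>u. \<partial>\<^bsub>c\<^esub> T u v) u"
      by (rule dir_deriv_cong[OF open_U assms])
         (simp_all add: dT_const assms
           smooth_map_differentiable[OF smooth_map_dir_deriv[OF smooth_T_const]])
    then show ?thesis by (simp add: ddT_const assms)
  qed
  then show ?thesis
    by (simp add: dir_deriv_commute[OF open_U smooth_T_const assms, of b c])
qed

lemma dT_\<phi>: 
  assumes "u \<in> U" shows "\<partial>\<^bsub>c\<^esub> T u (\<phi> u) = - T u (\<partial>\<^bsub>c\<^esub> \<phi> u)"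
proof -
  have "\<partial>\<^bsub>c\<^esub> (\<lambda>u. T u (\<phi> u)) u = 0"
    by (rule dir_deriv_zero[OF open_U assms]) (rule T_\<phi>)
  then show ?thesis
    by (simp add: dT_apply assms eq_neg_iff_add_eq_0 add.commute)
qed

lemma dT_N:
  assumes "u \<in> U" shows "\<partial>\<^bsub>c\<^esub> T u (N u) = - T u (\<partial>\<^bsub>c\<^esub> N u)"
proof -
  have "\<partial>\<^bsub>c\<^esub> (\<lambda>u. T u (N u)) u = 0"
    by (rule dir_deriv_zero[OF open_U assms]) (rule T_N)
  then show ?thesis
    by (simp add: dT_apply assms eq_neg_iff_add_eq_0 add.commute)
qed

text \<open>
  The derivative of \<open>T(\<partial>\<^sub>w \<phi>) = - \<partial>\<^sub>w N\<close> along \<open>v\<close> expresses the left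
  hand side by \<open>\<partial>\<^sub>v \<partial>\<^sub>w N\<close> and \<open>T(\<partial>\<^sub>v \<partial>\<^sub>w \<phi>)\<close>, both symmetric in
  \<open>v\<close> and \<open>w\<close>.
\<close>
lemma codazzi:
  assumes "u \<in> U"
  shows "\<partial>\<^bsub>v\<^esub> T u (\<partial>\<^bsub>w\<^esub> \<phi> u) = \<partial>\<^bsub>w\<^esub> T u (\<partial>\<^bsub>v\<^esub> \<phi> u)"
proof -
  have "\<partial>\<^bsub>v\<^esub> T u (\<partial>\<^bsub>w\<^esub> \<phi> u) = - \<partial>\<^bsub>v\<^esub> (\<partial>\<^bsub>w\<^esub> N) u - T u (\<partial>\<^bsub>v\<^esub> (\<partial>\<^bsub>w\<^esub> \<phi>) u)" for v w
  proof -
    have "\<partial>\<^bsub>v\<^esub> (\<lambda>u. T u (\<partial>\<^bsub>w\<^esub> \<phi> u)) u = \<partial>\<^bsub>v\<^esub> (\<lambda>u. - \<partial>\<^bsub>w\<^esub> N u) u"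
      by (rule dir_deriv_cong[OF open_U assms])
         (auto simp: T_d\<phi> intro!: assms smooth_map_differentiable[where U = U]
            smooth_map_blinfun_apply open_U smooth_T smooths)
    then show ?thesis
      by (simp add: dT_apply dir_deriv_uminus assms algebra_simps)
  qed
  then show ?thesis
    by (simp add: dd\<phi>_commute[OF assms, of v w] dir_deriv_commute[OF open_U smooth_N assms, of v w])
qed

lemma d_codazzi:
  assumes "u \<in> U"
  shows "\<partial>\<^bsub>c\<^esub> (\<partial>\<^bsub>v\<^esub> T) u (\<partial>\<^bsub>w\<^esub> \<phi> u) + \<partial>\<^bsub>v\<^esub> T u (\<partial>\<^bsub>c\<^esub> (\<partial>\<^bsub>w\<^esub> \<phi>) u)
       = \<partial>\<^bsub>c\<^esub> (\<partial>\<^bsub>w\<^esub> T) u (\<partial>\<^bsub>v\<^esub> \<phi> u) + \<partial>\<^bsub>w\<^esub> T u (\<partial>\<^bsub>c\<^esub> (\<partial>\<^bsub>v\<^esub> \<phi>) u)"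
proof -
  have "\<partial>\<^bsub>c\<^esub> (\<lambda>u. \<partial>\<^bsub>v\<^esub> T u (\<partial>\<^bsub>w\<^esub> \<phi> u)) u = \<partial>\<^bsub>c\<^esub> (\<lambda>u. \<partial>\<^bsub>w\<^esub> T u (\<partial>\<^bsub>v\<^esub> \<phi> u)) u"
    by (rule dir_deriv_cong[OF open_U assms codazzi])
       (auto intro!: assms smooth_map_differentiable[where U = U] smooth_map_blinfun_apply open_U
          smooth_map_dir_deriv smooth_T smooth_\<phi>)
  then show ?thesis
    by (simp add: dir_deriv_blinfun_apply assms add.commute)
qed

lemma T_eigenbasis:
  assumes "u \<in> U" 
  shows "\<exists>B. span B = UNIV \<and> (\<forall>b\<in>B. b \<noteq> 0 \<and> (\<exists>c. T u b = c *\<^sub>R b))"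
proof -
  have "linear (T u)"
    by (rule bounded_linear.linear[OF blinfun.bounded_linear_right])
  from self_adjoint_eigenbasis[OF this subspace_UNIV] T_self_adjoint[OF assms]
  obtain B where "span B = UNIV" "\<forall>b\<in>B. norm b = 1 \<and> (\<exists>c. T u b = c *\<^sub>R b)"
    by auto
  then show ?thesis by (intro exI[of _ B]) force
qed

text \<open>
  If all eigenvalues lie in a fixed finite set \<open>\<Lambda>\<close>, an eigenvector at one point extends to a smooth
  field of eigenvectors for the same eigenvalue \<open>l\<close>: apply to the constant vector \<open>a\<close> the product of
  all \<open>T - m\<close> with \<open>m \<in> \<Lambda> - {l}\<close>, and normalize. This polynomial in \<open>T\<close> is a
  multiple of the projection to the eigenspace, as every \<open>T y\<close> is diagonalizable with spectrum in
  \<open>\<Lambda>\<close>.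
\<close>
lemma eigenvector_field:
  assumes "u \<in> U" "T u a = l *\<^sub>R a" "finite \<Lambda>"
    and \<Lambda>: "\<And>y \<mu> v. \<lbrakk>y \<in> U; v \<noteq> 0; T y v = \<mu> *\<^sub>R v\<rbrakk> \<Longrightarrow> \<mu> \<in> \<Lambda>"
  shows "\<exists>x. smooth_map U x \<and> x u = a \<and> (\<forall>y\<in>U. T y (x y) = l *\<^sub>R x y)"
proof -
  have ex: "\<exists>z. smooth_map U z \<and> z u = (\<Prod>m\<leftarrow>ms. l - m) *\<^sub>R a \<and>
      (\<forall>y\<in>U. \<forall>b \<mu>. T y b = \<mu> *\<^sub>R b \<longrightarrow> z y \<bullet> b = (\<Prod>m\<leftarrow>ms. \<mu> - m) * (a \<bullet> b))" for ms
  proof (induction ms)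
    case Nil
    show ?case
      by (rule exI[of _ "\<lambda>_. a"]) (simp add: smooth_map_const)
  next
    case (Cons m ms)
    then obtain z where z: "smooth_map U z" "z u = (\<Prod>m\<leftarrow>ms. l - m) *\<^sub>R a"
      "\<And>y b \<mu>. y \<in> U \<Longrightarrow> T y b = \<mu> *\<^sub>R b \<Longrightarrow> z y \<bullet> b = (\<Prod>m\<leftarrow>ms. \<mu> - m) * (a \<bullet> b)"
      by blast
    show ?case
    proof (intro exI conjI ballI allI impI)
      show "smooth_map U (\<lambda>y. T y (z y) - m *\<^sub>R z y)"
        by (intro smooth_map_diff smooth_map_blinfun_apply smooth_map_scaleR open_U smooth_T z
            smooth_map_const)
      show "T u (z u) - m *\<^sub>R z u = (\<Prod>m\<leftarrow>m # ms. l - m) *\<^sub>R a"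
        by (simp add: z(2) blinfun.scaleR_right assms(2) algebra_simps)
      show "(T y (z y) - m *\<^sub>R z y) \<bullet> b = (\<Prod>m\<leftarrow>m # ms. \<mu> - m) * (a \<bullet> b)"
        if "y \<in> U" "T y b = \<mu> *\<^sub>R b" for y b \<mu>
        using z(3)[OF that] that by (simp add: inner_diff_left T_self_adjoint algebra_simps)
    qed
  qed
  obtain ms where ms: "set ms = \<Lambda> - {l}"
    using finite_list[of "\<Lambda> - {l}"] assms(3) by auto
  obtain z where zz: "smooth_map U z \<and> z u = (\<Prod>m\<leftarrow>ms. l - m) *\<^sub>R a \<and>
      (\<forall>y\<in>U. \<forall>b \<mu>. T y b = \<mu> *\<^sub>R b \<longrightarrow> z y \<bullet> b = (\<Prod>m\<leftarrow>ms. \<mu> - m) * (a \<bullet> b))"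
    using ex[of ms] by (rule exE)
  then have z: "smooth_map U z" "z u = (\<Prod>m\<leftarrow>ms. l - m) *\<^sub>R a"
    by simp_all
  have z3: "z y \<bullet> b = (\<Prod>m\<leftarrow>ms. \<mu> - m) * (a \<bullet> b)" if "y \<in> U" "T y b = \<mu> *\<^sub>R b" for y b \<mu>
    using zz that by simp_all
  define k where "k = (\<Prod>m\<leftarrow>ms. l - m)"
  have "k \<noteq> 0"
  proof -
    have "l - m \<noteq> 0" if "m \<in> set ms" for m
      using that unfolding ms by simp
    then have "0 \<notin> set (map (\<lambda>m. l - m) ms)"
      by (simp add: image_iff)
    then show ?thesis
      by (simp add: k_def prod_list_zero_iff)
  qed
  have eig: "T y (z y) = l *\<^sub>R z y" if y: "y \<in> U" for y
  proof -
    obtain B where B: "span B = UNIV" "\<forall>b\<in>B. b \<noteq> 0 \<and> (\<exists>c. T y b = c *\<^sub>R b)"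
      using T_eigenbasis[OF y] by (elim exE conjE)
    define r where "r = T y (z y) - l *\<^sub>R z y"
    have "orthogonal r b" if bB: "b \<in> B" for b
    proof -
      obtain \<mu> where \<mu>: "T y b = \<mu> *\<^sub>R b"
        using bspec[OF B(2) bB] by (elim conjE exE)
      have "\<mu> \<in> \<Lambda>"
        by (rule \<Lambda>[OF y _ \<mu>]) (use bspec[OF B(2) bB] in simp)
      have "r \<bullet> b = (\<mu> - l) * ((\<Prod>m\<leftarrow>ms. \<mu> - m) * (a \<bullet> b))"
        using z3[OF y \<mu>] by (simp add: r_def inner_diff_left T_self_adjoint[OF y] \<mu> left_diff_distrib)
      moreover have "(\<Prod>m\<leftarrow>ms. \<mu> - m) = 0" if "\<mu> \<noteq> l"
        unfolding prod_list_zero_iff using that \<open>\<mu> \<in> \<Lambda>\<close> ms by force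
      ultimately show ?thesis
        unfolding orthogonal_def by (cases "\<mu> = l") simp_all
    qed
    then have "orthogonal r r"
      using orthogonal_to_span[of r B r] B(1) by simp
    then show ?thesis by (simp add: orthogonal_def r_def)
  qed
  show ?thesis
  proof (intro exI conjI ballI)
    show "smooth_map U (\<lambda>y. (1 / k) *\<^sub>R z y)"
      by (intro smooth_map_scaleR open_U smooth_map_const z)
    show "(1 / k) *\<^sub>R z u = a"
      using \<open>k \<noteq> 0\<close> by (simp add: z(2) k_def)
    show "T y ((1 / k) *\<^sub>R z y) = l *\<^sub>R (1 / k) *\<^sub>R z y" if "y \<in> U" for y
      by (simp add: blinfun.scaleR_right eig[OF that])
  qed
qed

end

section \<open>Constant principal curvatures\<close>

text \<open>
  The three cyclic rotations of the summand have the same triple sum.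
\<close>
lemma sum_eq_0_if_cyclic:
  fixes t :: "'b \<Rightarrow> 'b \<Rightarrow> 'b \<Rightarrow> real"
  assumes "\<And>a b c. \<lbrakk>a \<in> B; b \<in> B; c \<in> B\<rbrakk> \<Longrightarrow> t a b c + t b c a + t c a b = 0"
  shows "(\<Sum>a\<in>B. \<Sum>b\<in>B. \<Sum>c\<in>B. t a b c) = 0"
proof -
  have rot: "(\<Sum>a\<in>B. \<Sum>b\<in>B. \<Sum>c\<in>B. s b c a) = (\<Sum>a\<in>B. \<Sum>b\<in>B. \<Sum>c\<in>B. s a b c)"
    for s :: "'b \<Rightarrow> 'b \<Rightarrow> 'b \<Rightarrow> real"
  proof -
    have "(\<Sum>a\<in>B. \<Sum>b\<in>B. \<Sum>c\<in>B. s b c a) = (\<Sum>b\<in>B. \<Sum>a\<in>B. \<Sum>c\<in>B. s b c a)"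
      by (rule sum.swap)
    also have "\<dots> = (\<Sum>b\<in>B. \<Sum>c\<in>B. \<Sum>a\<in>B. s b c a)"
      by (intro sum.cong refl sum.swap)
    finally show ?thesis .
  qed
  have "(\<Sum>a\<in>B. \<Sum>b\<in>B. \<Sum>c\<in>B. t a b c + t b c a + t c a b) = 0"
    using assms by simp
  then show ?thesis
    using rot[of t] rot[of "\<lambda>a b c. t b c a"] by (simp add: sum.distrib)
qed

text \<open>
  The isoparametric condition in terms of \<open>T\<close>: the spectra of all the operators \<open>T y\<close> lie in one
  finite set. The orthonormal eigenbasis \<open>B\<close> of the tangent space belongs to the single point \<open>u\<close>.
\<close>
locale isoparametric_patch = sphere_patch U \<phi> N
  for U :: "(real^'n::finite) set" and \<phi> N :: "real^'n \<Rightarrow> 'a::euclidean_space" +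
  fixes \<Lambda> :: "real set" and u :: "real^'n" and B :: "'a set" and lam :: "'a \<Rightarrow> real"
  assumes u: "u \<in> U"
    and finite_\<Lambda>: "finite \<Lambda>"
    and eigenvalue_\<Lambda>: "\<lbrakk>y \<in> U; v \<noteq> 0; T y v = \<mu> *\<^sub>R v\<rbrakk> \<Longrightarrow> \<mu> \<in> \<Lambda>"
    and B: "finite B" "pairwise orthogonal B" "b \<in> B \<Longrightarrow> norm b = 1"
      "span B = range (\<lambda>w. \<partial>\<^bsub>w\<^esub> \<phi> u)"
    and lam: "b \<in> B \<Longrightarrow> T u b = lam b *\<^sub>R b"
begin

lemma B_inner: "a \<in> B \<Longrightarrow> b \<in> B \<Longrightarrow> a \<bullet> b = (if a = b then 1 else 0)"
  using B(2,3) by (auto simp: pairwise_def orthogonal_def dot_square_norm)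

text \<open>
  The coordinate direction that corresponds to a tangent vector at \<open>u\<close>. Derivatives along the vectors of
  \<open>B\<close> are taken in these fixed directions of \<open>\<real>\<^sup>n\<close>, so they commute.
\<close>
definition w :: "'a \<Rightarrow> real^'n" where
  "w b = (SOME x. \<partial>\<^bsub>x\<^esub> \<phi> u = b)"

lemma d\<phi>_w: "b \<in> B \<Longrightarrow> \<partial>\<^bsub>w b\<^esub> \<phi> u = b"
proof -
  assume "b \<in> B"
  then have "b \<in> range (\<lambda>w. \<partial>\<^bsub>w\<^esub> \<phi> u)"
    using B(4) span_base by blast
  then have "\<exists>x. \<partial>\<^bsub>x\<^esub> \<phi> u = b" by auto
  then show ?thesis unfolding w_def by (rule someI_ex)
qed

lemma dN_w: "b \<in> B \<Longrightarrow> \<partial>\<^bsub>w b\<^esub> N u = - lam b *\<^sub>R b"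
  using T_d\<phi>[OF u, of "w b"] by (simp add: d\<phi>_w lam)

lemma B_tangent: "b \<in> B \<Longrightarrow> b \<bullet> \<phi> u = 0" "b \<in> B \<Longrightarrow> b \<bullet> N u = 0"
  using d\<phi>_w[of b] \<phi>_d\<phi>[OF u, of "w b"] N_d\<phi>[OF u, of "w b"] by (simp_all add: inner_commute)

text \<open>
  The components of the covariant derivative of the second fundamental form at \<open>u\<close>, with
  the direction of differentiation last.
\<close>
definition h :: "'a \<Rightarrow> 'a \<Rightarrow> 'a \<Rightarrow> real" where
  "h a b c = \<partial>\<^bsub>w c\<^esub> T u a \<bullet> b"

lemma h_swap: "h a b c = h b a c"
  unfolding h_def using dT_self_adjoint[OF u, of "w c" a b] by (simp add: inner_commute)

lemma dT_w_commute: "a \<in> B \<Longrightarrow> b \<in> B \<Longrightarrow> \<partial>\<^bsub>w b\<^esub> T u a = \<partial>\<^bsub>w a\<^esub> T u b"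
  using codazzi[OF u, of "w b" "w a"] by (simp add: d\<phi>_w)

lemma h_rotate: "a \<in> B \<Longrightarrow> c \<in> B \<Longrightarrow> h a b c = h c b a"
  unfolding h_def by (simp add: dT_w_commute[of a c])

lemma B_eigenvector_field:
  assumes "a \<in> B"
  shows "\<exists>x. smooth_map U x \<and> x u = a \<and> (\<forall>y\<in>U. T y (x y) = lam a *\<^sub>R x y)"
  by (rule eigenvector_field[OF u lam[OF assms] finite_\<Lambda> eigenvalue_\<Lambda>])

lemma eigenvector_field_deriv:
  assumes "smooth_map U x" "\<forall>y\<in>U. T y (x y) = l *\<^sub>R x y" "y \<in> U"
  shows "\<partial>\<^bsub>c\<^esub> T y (x y) + T y (\<partial>\<^bsub>c\<^esub> x y) = l *\<^sub>R \<partial>\<^bsub>c\<^esub> x y"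
proof -
  have d: "x differentiable at y"
    by (rule smooth_map_differentiable[OF assms(1,3)])
  have "\<partial>\<^bsub>c\<^esub> (\<lambda>y. T y (x y)) y = \<partial>\<^bsub>c\<^esub> (\<lambda>y. l *\<^sub>R x y) y"
    by (rule dir_deriv_cong[OF open_U assms(3)])
       (auto simp: assms(2) intro!: assms smooth_map_differentiable[where U = U]
          smooth_map_blinfun_apply open_U smooth_T)
  then show ?thesis
    by (simp add: dT_apply assms(3) d dir_deriv_scaleR dir_deriv_const add.commute)
qed

text \<open>
  Differentiate \<open>T x = \<lambda> x\<close> for a field \<open>x\<close> of eigenvectors through \<open>a\<close> and take the inner
  product with an eigenvector \<open>b\<close> of the same eigenvalue: the derivative of \<open>x\<close> drops out.
\<close>
lemma h_eq_eigenvalue: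
  assumes "a \<in> B" "b \<in> B" "lam a = lam b"
  shows "h a b c = 0"
proof -
  obtain x where x: "smooth_map U x" "x u = a" "\<forall>y\<in>U. T y (x y) = lam a *\<^sub>R x y"
    using B_eigenvector_field[OF assms(1)] by (elim exE conjE)
  have "\<partial>\<^bsub>w c\<^esub> T u a + T u (\<partial>\<^bsub>w c\<^esub> x u) = lam a *\<^sub>R \<partial>\<^bsub>w c\<^esub> x u"
    using eigenvector_field_deriv[OF x(1,3) u] by (simp add: x(2))
  then have "(\<partial>\<^bsub>w c\<^esub> T u a + T u (\<partial>\<^bsub>w c\<^esub> x u)) \<bullet> b = (lam a *\<^sub>R \<partial>\<^bsub>w c\<^esub> x u) \<bullet> b"
    by simp
  then show ?thesis
    by (simp add: h_def inner_add_left T_self_adjoint[OF u] lam assms)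
qed

lemma h_distinct:
  assumes "a \<in> B" "b \<in> B" "c \<in> B" "h a b c \<noteq> 0"
  shows "lam a \<noteq> lam b" "lam a \<noteq> lam c" "lam b \<noteq> lam c"
proof -
  show "lam a \<noteq> lam b" using h_eq_eigenvalue assms by blast
  show "lam b \<noteq> lam c" using h_eq_eigenvalue[of c b a] h_rotate[of a c b] assms by auto
  show "lam a \<noteq> lam c"
    using h_eq_eigenvalue[of a c b] h_rotate[of b c a] h_swap[of a b c] h_swap[of c a b] assms by auto
qed

lemma adapted_expansion:
  "v = (\<Sum>c\<in>B. (v \<bullet> c) *\<^sub>R c) + (v \<bullet> \<phi> u) *\<^sub>R \<phi> u + (v \<bullet> N u) *\<^sub>R N u"
proof -
  define t where "t = v - (v \<bullet> \<phi> u) *\<^sub>R \<phi> u - (v \<bullet> N u) *\<^sub>R N u"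
  have "t \<bullet> \<phi> u = 0" "t \<bullet> N u = 0"
    using \<phi>_\<phi>[OF u] N_N[OF u] N_\<phi>[OF u]
    by (simp_all add: t_def inner_diff_left inner_commute[of "\<phi> u" "N u"])
  then have "t \<in> span B"
    unfolding B(4) range_d\<phi>[OF u] by simp
  then have "(\<Sum>c\<in>B. (t \<bullet> c) *\<^sub>R c) = t"
    using B by (intro orthonormal_basis_expand) auto
  moreover have "(\<Sum>c\<in>B. (t \<bullet> c) *\<^sub>R c) = (\<Sum>c\<in>B. (v \<bullet> c) *\<^sub>R c)"
    by (intro sum.cong refl) (simp add: t_def inner_diff_left B_tangent inner_commute[of "\<phi> u"]
        inner_commute[of "N u"])
  ultimately have "t = (\<Sum>c\<in>B. (v \<bullet> c) *\<^sub>R c)"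
    by simp
  moreover have "v = t + (v \<bullet> \<phi> u) *\<^sub>R \<phi> u + (v \<bullet> N u) *\<^sub>R N u"
    by (simp add: t_def)
  ultimately show ?thesis by simp
qed

lemma dT_\<phi>_component:
  assumes "a \<in> B" "b \<in> B"
  shows "\<partial>\<^bsub>w b\<^esub> T u a \<bullet> \<phi> u = (if a = b then - lam a else 0)"
proof -
  have "\<partial>\<^bsub>w b\<^esub> T u a \<bullet> \<phi> u = - (a \<bullet> T u b)"
    by (simp add: dT_self_adjoint[OF u] dT_\<phi>[OF u] d\<phi>_w assms)
  then show ?thesis
    by (simp add: lam B_inner assms)
qed

lemma dT_N_component:
  assumes "a \<in> B" "b \<in> B"
  shows "\<partial>\<^bsub>w b\<^esub> T u a \<bullet> N u = (if a = b then (lam a)\<^sup>2 else 0)"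
proof -
  have "\<partial>\<^bsub>w b\<^esub> T u a \<bullet> N u = a \<bullet> T u (lam b *\<^sub>R b)"
    by (simp add: dT_self_adjoint[OF u] dT_N[OF u] dN_w assms blinfun.minus_right)
  then show ?thesis
    by (simp add: lam B_inner assms blinfun.scaleR_right power2_eq_square)
qed

text \<open>
  Second order perturbation of a constant eigenvalue. For a field \<open>x\<close> of eigenvectors through \<open>a\<close>, with
  primes for derivatives in the direction of \<open>b\<close>, the second derivative of \<open>T x = \<lambda> x\<close> has inner
  product \<open>T'' a \<bullet> a + 2 x' \<bullet> T' a = 0\<close> with \<open>a\<close>, and the first derivative determines the
  components of \<open>x'\<close> that matter, since \<open>T' a\<close> has no component in the eigenspace of
  \<open>a\<close> and, because of \<open>a \<noteq> b\<close>, none in the normal plane.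
\<close>
lemma second_variation:
  assumes ab: "a \<in> B" "b \<in> B" "a \<noteq> b"
  shows "\<partial>\<^bsub>w b\<^esub> (\<partial>\<^bsub>w b\<^esub> T) u a \<bullet> a = - 2 * (\<Sum>c\<in>B. (h a b c)\<^sup>2 / (lam a - lam c))"
proof -
  obtain x where x: "smooth_map U x" "x u = a" "\<forall>y\<in>U. T y (x y) = lam a *\<^sub>R x y"
    using B_eigenvector_field[OF ab(1)] by (elim exE conjE)
  let ?v = "w b"
  define x' where "x' = \<partial>\<^bsub>?v\<^esub> x u"
  define x'' where "x'' = \<partial>\<^bsub>?v\<^esub> (\<partial>\<^bsub>?v\<^esub> x) u"
  have dx: "x differentiable at u" "\<partial>\<^bsub>?v\<^esub> x differentiable at u"
    by (auto intro!: smooth_map_differentiable[OF _ u] smooth_map_dir_deriv x(1))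
  have 1: "\<partial>\<^bsub>?v\<^esub> T u a + T u x' = lam a *\<^sub>R x'"
    using eigenvector_field_deriv[OF x(1,3) u, of ?v] by (simp add: x(2) x'_def)
  have "\<partial>\<^bsub>?v\<^esub> (\<lambda>y. \<partial>\<^bsub>?v\<^esub> T y (x y) + T y (\<partial>\<^bsub>?v\<^esub> x y)) u = \<partial>\<^bsub>?v\<^esub> (\<lambda>y. lam a *\<^sub>R \<partial>\<^bsub>?v\<^esub> x y) u"
    by (rule dir_deriv_cong[OF open_U u])
       (auto simp: eigenvector_field_deriv[OF x(1,3)] intro!: u x(1)
          smooth_map_differentiable[where U = U] smooth_map_add smooth_map_blinfun_apply open_U smooth_T
          smooth_map_dir_deriv)
  moreover have "\<partial>\<^bsub>?v\<^esub> (\<lambda>y. \<partial>\<^bsub>?v\<^esub> T y (x y) + T y (\<partial>\<^bsub>?v\<^esub> x y)) u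
      = \<partial>\<^bsub>?v\<^esub> (\<lambda>y. \<partial>\<^bsub>?v\<^esub> T y (x y)) u + \<partial>\<^bsub>?v\<^esub> (\<lambda>y. T y (\<partial>\<^bsub>?v\<^esub> x y)) u"
    by (rule dir_deriv_add)
       (auto intro!: u x(1) smooth_map_differentiable[where U = U] smooth_map_blinfun_apply open_U smooth_T
          smooth_map_dir_deriv)
  ultimately have 2: "\<partial>\<^bsub>?v\<^esub> (\<partial>\<^bsub>?v\<^esub> T) u a + 2 *\<^sub>R \<partial>\<^bsub>?v\<^esub> T u x' + T u x'' = lam a *\<^sub>R x''"
    by (simp add: dir_deriv_blinfun_apply u dx dir_deriv_scaleR dir_deriv_const x(2) x'_def x''_def
        scaleR_2 algebra_simps)
  have "T u x'' \<bullet> a = (lam a *\<^sub>R x'') \<bullet> a"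
    by (simp add: T_self_adjoint[OF u] lam ab)
  with arg_cong[OF 2, of "\<lambda>z. z \<bullet> a"]
  have "\<partial>\<^bsub>?v\<^esub> (\<partial>\<^bsub>?v\<^esub> T) u a \<bullet> a = - 2 * (x' \<bullet> \<partial>\<^bsub>?v\<^esub> T u a)"
    by (simp add: inner_add_left dT_self_adjoint[OF u])
  also have "\<partial>\<^bsub>?v\<^esub> T u a = (\<Sum>c\<in>B. h a c b *\<^sub>R c)"
    using adapted_expansion[of "\<partial>\<^bsub>?v\<^esub> T u a"]
    by (simp add: dT_\<phi>_component dT_N_component ab h_def)
  also have "x' \<bullet> \<dots> = (\<Sum>c\<in>B. (h a b c)\<^sup>2 / (lam a - lam c))"
    unfolding inner_sum_right
  proof (rule sum.cong)
    fix c assume c: "c \<in> B"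
    have hh: "h a c b = h a b c"
      using h_swap[of a c b] h_rotate[of c b a] h_swap[of b a c] ab c by simp
    have eq: "h a c b = (lam a - lam c) * (x' \<bullet> c)"
      using arg_cong[OF 1, of "\<lambda>z. z \<bullet> c"]
      by (simp add: inner_add_left T_self_adjoint[OF u] lam c h_def algebra_simps)
    show "x' \<bullet> h a c b *\<^sub>R c = (h a b c)\<^sup>2 / (lam a - lam c)"
    proof (cases "lam a = lam c")
      case True
      then have "h a c b = 0" using h_eq_eigenvalue ab(1) c by blast
      then show ?thesis using True by simp
    next
      case False
      then have "x' \<bullet> c = h a b c / (lam a - lam c)"
        using eq hh by (simp add: field_simps)
      then show ?thesis
        using hh by (simp add: power2_eq_square)
    qed
  qed simp
  finally show ?thesis .
qed

text \<open>
  The differentiated Codazzi equation \<open>d_codazzi\<close> is used for the pair \<open>(a, b)\<close> and for \<open>(b, a)\<close>.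
  The mixed second derivatives of \<open>T\<close> agree and so do the terms containing the mixed derivative of
  \<open>\<phi>\<close>. What remains is the pairing of \<open>\<partial>\<^sub>b \<partial>\<^sub>b \<phi>\<close> with the derivative of \<open>T\<close> in
  the direction of \<open>a\<close> at \<open>a\<close>, which is normal since \<open>h\<^sub>a\<^sub>c\<^sub>a = 0\<close> for all \<open>c\<close>.
\<close>
lemma second_variation_difference:
  assumes ab: "a \<in> B" "b \<in> B"
  shows "\<partial>\<^bsub>w b\<^esub> (\<partial>\<^bsub>w b\<^esub> T) u a \<bullet> a - \<partial>\<^bsub>w a\<^esub> (\<partial>\<^bsub>w a\<^esub> T) u b \<bullet> b
    = (lam a - lam b) * (1 + lam a * lam b)"
proof -
  have *: "\<partial>\<^bsub>w b\<^esub> (\<partial>\<^bsub>w b\<^esub> T) u a \<bullet> a + \<partial>\<^bsub>w b\<^esub> (\<partial>\<^bsub>w a\<^esub> \<phi>) u \<bullet> \<partial>\<^bsub>w b\<^esub> T u a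
      = \<partial>\<^bsub>w b\<^esub> (\<partial>\<^bsub>w a\<^esub> T) u b \<bullet> a + lam a + lam b * (lam a)\<^sup>2"
    if ab: "a \<in> B" "b \<in> B" for a b
  proof -
    have "\<partial>\<^bsub>w a\<^esub> T u a = (lam a)\<^sup>2 *\<^sub>R N u - lam a *\<^sub>R \<phi> u"
    proof -
      have "\<partial>\<^bsub>w a\<^esub> T u a \<bullet> c = 0" if "c \<in> B" for c
        using h_eq_eigenvalue[of a a c] h_rotate[of a c a] h_swap[of c a a] ab that
        by (simp add: h_def)
      then show ?thesis
        using adapted_expansion[of "\<partial>\<^bsub>w a\<^esub> T u a"]
        by (simp add: dT_\<phi>_component dT_N_component ab)
    qed
    then have "\<partial>\<^bsub>w b\<^esub> (\<partial>\<^bsub>w b\<^esub> \<phi>) u \<bullet> \<partial>\<^bsub>w a\<^esub> T u a = lam a + lam b * (lam a)\<^sup>2"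
      by (simp add: inner_diff_right dd\<phi>_\<phi>[OF u] dd\<phi>_N[OF u] d\<phi>_w dN_w ab B_inner)
    moreover have "\<partial>\<^bsub>w b\<^esub> (\<partial>\<^bsub>w b\<^esub> T) u a + \<partial>\<^bsub>w b\<^esub> T u (\<partial>\<^bsub>w b\<^esub> (\<partial>\<^bsub>w a\<^esub> \<phi>) u)
        = \<partial>\<^bsub>w b\<^esub> (\<partial>\<^bsub>w a\<^esub> T) u b + \<partial>\<^bsub>w a\<^esub> T u (\<partial>\<^bsub>w b\<^esub> (\<partial>\<^bsub>w b\<^esub> \<phi>) u)"
      using d_codazzi[OF u, of "w b" "w b" "w a"] by (simp add: d\<phi>_w ab)
    then have "(\<partial>\<^bsub>w b\<^esub> (\<partial>\<^bsub>w b\<^esub> T) u a + \<partial>\<^bsub>w b\<^esub> T u (\<partial>\<^bsub>w b\<^esub> (\<partial>\<^bsub>w a\<^esub> \<phi>) u)) \<bullet> a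
        = (\<partial>\<^bsub>w b\<^esub> (\<partial>\<^bsub>w a\<^esub> T) u b + \<partial>\<^bsub>w a\<^esub> T u (\<partial>\<^bsub>w b\<^esub> (\<partial>\<^bsub>w b\<^esub> \<phi>) u)) \<bullet> a"
      by simp
    ultimately show ?thesis
      by (simp add: inner_add_left dT_self_adjoint[OF u])
  qed
  have "\<partial>\<^bsub>w b\<^esub> (\<partial>\<^bsub>w a\<^esub> T) u b \<bullet> a = \<partial>\<^bsub>w a\<^esub> (\<partial>\<^bsub>w b\<^esub> T) u a \<bullet> b"
    by (simp add: ddT_commute[OF u, of "w b" "w a"] ddT_self_adjoint[OF u, of _ _ b]
        inner_commute[of b])
  moreover have "\<partial>\<^bsub>w b\<^esub> (\<partial>\<^bsub>w a\<^esub> \<phi>) u \<bullet> \<partial>\<^bsub>w b\<^esub> T u a = \<partial>\<^bsub>w a\<^esub> (\<partial>\<^bsub>w b\<^esub> \<phi>) u \<bullet> \<partial>\<^bsub>w a\<^esub> T u b"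
    by (simp add: dd\<phi>_commute[OF u, of "w b" "w a"] dT_w_commute[OF ab])
  ultimately have "\<partial>\<^bsub>w b\<^esub> (\<partial>\<^bsub>w b\<^esub> T) u a \<bullet> a - \<partial>\<^bsub>w a\<^esub> (\<partial>\<^bsub>w a\<^esub> T) u b \<bullet> b
      = (lam a + lam b * (lam a)\<^sup>2) - (lam b + lam a * (lam b)\<^sup>2)"
    using *[OF ab] *[OF ab(2,1)] by linarith
  then show ?thesis
    by (simp add: power2_eq_square algebra_simps)
qed

text \<open>
  The left hand side is the sectional curvature of the plane of \<open>a\<close> and \<open>b\<close>. Terms with
  \<open>\<lambda>\<^sub>c \<in> {\<lambda>\<^sub>a, \<lambda>\<^sub>b}\<close> have vanishing numerator as well as denominator, and count as zero.
\<close>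
lemma sectional_curvature_eq:
  assumes ab: "a \<in> B" "b \<in> B" "lam a \<noteq> lam b"
  shows "1 + lam a * lam b
    = 2 * (\<Sum>c\<in>B. (h a b c)\<^sup>2 / ((lam a - lam c) * (lam b - lam c)))"
proof -
  have "a \<noteq> b" using ab(3) by blast
  have frac: "- (h a b c)\<^sup>2 / (lam a - lam c) + (h a b c)\<^sup>2 / (lam b - lam c)
      = (lam a - lam b) * ((h a b c)\<^sup>2 / ((lam a - lam c) * (lam b - lam c)))" if "c \<in> B" for c
  proof (cases "h a b c = 0")
    case False
    then have "lam a \<noteq> lam c" "lam b \<noteq> lam c"
      using h_distinct ab that by blast+
    then show ?thesis by (simp add: divide_simps) (simp add: algebra_simps)
  qed simp
  have "(lam a - lam b) * (1 + lam a * lam b)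
      = - 2 * (\<Sum>c\<in>B. (h a b c)\<^sup>2 / (lam a - lam c)) + 2 * (\<Sum>c\<in>B. (h b a c)\<^sup>2 / (lam b - lam c))"
    using second_variation[of a b] second_variation[of b a] second_variation_difference[of a b] ab
      \<open>a \<noteq> b\<close> by simp
  also have "\<dots> = 2 * (\<Sum>c\<in>B. - (h a b c)\<^sup>2 / (lam a - lam c) + (h a b c)\<^sup>2 / (lam b - lam c))"
    by (simp add: sum_subtractf sum.distrib sum_negf h_swap[of b a])
  also have "(\<Sum>c\<in>B. - (h a b c)\<^sup>2 / (lam a - lam c) + (h a b c)\<^sup>2 / (lam b - lam c))
      = (lam a - lam b) * (\<Sum>c\<in>B. (h a b c)\<^sup>2 / ((lam a - lam c) * (lam b - lam c)))"
    unfolding sum_distrib_left by (intro sum.cong refl frac)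
  finally show ?thesis using ab(3) by (simp add: mult.left_commute[of 2])
qed

lemma card_B: "card B = CARD('n)"
proof -
  have "independent B"
    using B by (intro pairwise_orthogonal_independent) force+
  then have "card B = dim (range (\<lambda>w. \<partial>\<^bsub>w\<^esub> \<phi> u))"
    by (metis B(4) dim_eq_card_independent dim_span)
  also have "\<dots> = CARD('n)"
    using dim_image_eq[OF linear_d\<phi>[OF u], of UNIV] immersion[OF u] by simp
  finally show ?thesis .
qed

theorem scalar_curvature_nonneg: "0 \<le> scalar_curvature g u"
proof -
  \<comment> \<open>If two of the three eigenvalues agree, \<open>t\<close> vanishes along with \<open>h\<close>, so the sum of \<open>t\<close> over
    all triples involves no other pairs than those with distinct eigenvalues.\<close>
  define t where "t a b c = (h a b c)\<^sup>2 / ((lam a - lam c) * (lam b - lam c))" for a b c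
  define f where "f a b = (if a = b then 0 else 1 + lam a * lam b)" for a b
  have "(\<Sum>a\<in>B. \<Sum>b\<in>B. \<Sum>c\<in>B. t a b c) = 0"
  proof (rule sum_eq_0_if_cyclic)
    fix a b c assume abc: "a \<in> B" "b \<in> B" "c \<in> B"
    have h: "h b c a = h a b c" "h c a b = h a b c"
      using abc h_rotate h_swap by metis+
    show "t a b c + t b c a + t c a b = 0"
    proof (cases "h a b c = 0")
      case False
      note ne = h_distinct[OF abc False]
      have "1 / ((x - z) * (y - z)) + 1 / ((y - x) * (z - x)) + 1 / ((z - y) * (x - y)) = 0"
        if "x \<noteq> y" "x \<noteq> z" "y \<noteq> z" for x y z :: real
        using that by (simp add: divide_simps) (simp add: algebra_simps)
      from this[OF ne] have "(h a b c)\<^sup>2 * (1 / ((lam a - lam c) * (lam b - lam c))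
          + 1 / ((lam b - lam a) * (lam c - lam a)) + 1 / ((lam c - lam b) * (lam a - lam b))) = 0"
        by simp
      then show ?thesis
        by (simp add: t_def h distrib_left)
    qed (simp add: t_def h)
  qed
  then have "0 = (\<Sum>a\<in>B. \<Sum>b\<in>B. 2 * (\<Sum>c\<in>B. t a b c))"
    by (simp flip: sum_distrib_left)
  also have "\<dots> \<le> (\<Sum>a\<in>B. \<Sum>b\<in>B. f a b)"
  proof (intro sum_mono)
    fix a b assume ab: "a \<in> B" "b \<in> B"
    show "2 * (\<Sum>c\<in>B. t a b c) \<le> f a b"
    proof (cases "lam a = lam b")
      case True
      then have "(\<Sum>c\<in>B. t a b c) = 0"
        using h_eq_eigenvalue[OF ab] by (simp add: t_def)
      then show ?thesis using True by (simp add: f_def)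
    next
      case False
      then show ?thesis
        using sectional_curvature_eq[OF ab] by (auto simp: f_def t_def)
    qed
  qed
  also have "(\<Sum>a\<in>B. \<Sum>b\<in>B. f a b)
      = (\<Sum>a\<in>B. (\<Sum>b\<in>B. 1 + lam a * lam b) - (1 + (lam a)\<^sup>2))"
  proof (rule sum.cong)
    fix a assume a: "a \<in> B"
    have "(\<Sum>b\<in>B. f a b) = (\<Sum>b\<in>B. (1 + lam a * lam b) - (if a = b then 1 + (lam a)\<^sup>2 else 0))"
      by (intro sum.cong) (auto simp: f_def power2_eq_square)
    then show "(\<Sum>b\<in>B. f a b) = (\<Sum>b\<in>B. 1 + lam a * lam b) - (1 + (lam a)\<^sup>2)"
      using a B(1) by (simp add: sum_subtractf)
  qed simp
  also have "\<dots> = scalar_curvature g u"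
    using scalar_curvature_eq_eigenvalues[OF u B lam]
    by (simp add: sum_subtractf sum.distrib card_B power2_eq_square algebra_simps
        flip: sum_distrib_left sum_distrib_right)
  finally show ?thesis .
qed

end

section \<open>Tangent spaces and the shape operator in a parametrization\<close>

text \<open>
  Near \<open>u\<close> the immersion satisfies \<open>\<bar>\<phi> w - \<phi> u\<bar> \<ge> c/2 \<bar>w - u\<bar>\<close>, so
  an error that is small compared to \<open>\<bar>w - u\<bar>\<close> is small compared to the distance of the image points.
  Continuity of \<open>\<psi>\<close> ensures that points of the image near \<open>\<phi> u\<close> have parameters near
  \<open>u\<close>.
\<close>
lemma has_derivative_within_immersed_image:
  fixes \<phi> :: "'a::euclidean_space \<Rightarrow> 'b::euclidean_space" and \<nu> :: "'b \<Rightarrow> 'c::real_normed_vector"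
  assumes u: "u \<in> U"
    and \<psi>: "continuous_on (\<phi> ` U) \<psi>" "\<And>w. w \<in> U \<Longrightarrow> \<psi> (\<phi> w) = w"
    and \<phi>': "(\<phi> has_derivative \<phi>') (at u)" "inj \<phi>'"
    and N': "((\<lambda>w. \<nu> (\<phi> w)) has_derivative N') (at u)"
    and L: "bounded_linear L" "\<And>w. L (\<phi>' w) = N' w"
  shows "(\<nu> has_derivative L) (at (\<phi> u) within \<phi> ` U)"
  unfolding has_derivative_within_alt
proof (intro conjI allI impI)
  show "bounded_linear L" by fact
  fix e :: real assume "e > 0"
  interpret L: bounded_linear L by fact
  obtain c where c: "c > 0" "\<And>x. c * norm x \<le> norm (\<phi>' x)"
    using linear_inj_bounded_below_pos[OF has_derivative_linear[OF \<phi>'(1)] \<phi>'(2)] by blast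
  obtain K where K: "K > 0" "\<And>y. norm (L y) \<le> norm y * K"
    using L.pos_bounded by blast
  \<comment> \<open>The first bound gives the lower estimate for \<open>\<phi>\<close>; by the second, applying \<open>L\<close> to the
    linearization error of \<open>\<phi>\<close> costs at most half of the allowed error.\<close>
  define a where "a = min (c / 2) (e * c / (4 * K))"
  have "a > 0" "a \<le> c / 2" "a * K \<le> e * c / 4"
    using c(1) K(1) \<open>e > 0\<close> by (auto simp: a_def min_def field_simps)
  obtain d1 where d1: "d1 > 0"
    "\<And>w. norm (w - u) < d1 \<Longrightarrow> norm (\<phi> w - \<phi> u - \<phi>' (w - u)) \<le> a * norm (w - u)"
    using \<phi>'(1) \<open>a > 0\<close> unfolding has_derivative_at_alt by blast
  have "e * c / 4 > 0" using \<open>e > 0\<close> c(1) by simp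
  then obtain d2 where d2: "d2 > 0"
    "\<And>w. norm (w - u) < d2 \<Longrightarrow> norm (\<nu> (\<phi> w) - \<nu> (\<phi> u) - N' (w - u)) \<le> e * c / 4 * norm (w - u)"
    using N' unfolding has_derivative_at_alt by blast
  obtain d where d: "d > 0"
    "\<And>y. y \<in> \<phi> ` U \<Longrightarrow> dist y (\<phi> u) < d \<Longrightarrow> dist (\<psi> y) (\<psi> (\<phi> u)) < min d1 d2"
    using \<psi>(1) d1(1) d2(1) u unfolding continuous_on_iff
    by (metis image_eqI min_less_iff_conj)
  show "\<exists>d>0. \<forall>y\<in>\<phi> ` U. norm (y - \<phi> u) < d \<longrightarrow>
      norm (\<nu> y - \<nu> (\<phi> u) - L (y - \<phi> u)) \<le> e * norm (y - \<phi> u)"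
  proof (intro exI[of _ d] conjI ballI impI d(1))
    fix y assume y: "y \<in> \<phi> ` U" "norm (y - \<phi> u) < d"
    then obtain w where w: "w \<in> U" "y = \<phi> w" by blast
    define r where "r = norm (w - u)"
    have "r < d1" "r < d2"
      using d(2)[OF y(1)] y(2) w u \<psi>(2) by (auto simp: dist_norm r_def)
    then have 1: "norm (\<phi> w - \<phi> u - \<phi>' (w - u)) \<le> a * r"
      and 2: "norm (\<nu> (\<phi> w) - \<nu> (\<phi> u) - N' (w - u)) \<le> e * c / 4 * r"
      using d1(2)[of w] d2(2)[of w] by (auto simp: r_def)
    have r: "c / 2 * r \<le> norm (y - \<phi> u)"
    proof -
      have "c * r \<le> norm (\<phi>' (w - u))" using c(2) by (simp add: r_def)
      also have "\<dots> \<le> norm (y - \<phi> u) + norm (\<phi> w - \<phi> u - \<phi>' (w - u))"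
        using norm_triangle_ineq4[of "\<phi> w - \<phi> u" "\<phi> w - \<phi> u - \<phi>' (w - u)"] w by simp
      also have "\<dots> \<le> norm (y - \<phi> u) + c / 2 * r"
        using 1 mult_right_mono[OF \<open>a \<le> c / 2\<close>, of r] by (simp add: r_def)
      finally show ?thesis by simp
    qed
    have "norm (\<nu> y - \<nu> (\<phi> u) - L (y - \<phi> u))
        = norm ((\<nu> (\<phi> w) - \<nu> (\<phi> u) - N' (w - u)) - L (\<phi> w - \<phi> u - \<phi>' (w - u)))"
      by (simp add: w L.diff L(2))
    also have "\<dots> \<le> e * c / 4 * r + (a * r) * K"
      using norm_triangle_ineq4 2 K(2)[of "\<phi> w - \<phi> u - \<phi>' (w - u)"] mult_right_mono[OF 1, of K] K(1)
      by (smt (verit))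
    also have "\<dots> \<le> e * c / 4 * r + e * c / 4 * r"
      using mult_right_mono[OF \<open>a * K \<le> e * c / 4\<close>, of r] by (simp add: r_def mult_ac)
    also have "\<dots> = e * (c / 2 * r)" by simp
    also have "\<dots> \<le> e * norm (y - \<phi> u)"
      using r \<open>e > 0\<close> by (intro mult_left_mono) auto
    finally show "norm (\<nu> y - \<nu> (\<phi> u) - L (y - \<phi> u)) \<le> e * norm (y - \<phi> u)" .
  qed
qed

lemma inner_vector_derivative_zero:
  fixes \<gamma> :: "real \<Rightarrow> 'a::real_inner"
  assumes "(\<gamma> has_vector_derivative v) (at 0)" "\<epsilon> > 0"
    and "\<And>t. t \<in> {-\<epsilon><..<\<epsilon>} \<Longrightarrow> \<gamma> t \<bullet> \<gamma> t = c"
  shows "\<gamma> 0 \<bullet> v = 0"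
proof -
  have "((\<lambda>t. \<gamma> t \<bullet> \<gamma> t) has_derivative (\<lambda>t. \<gamma> 0 \<bullet> (t *\<^sub>R v) + (t *\<^sub>R v) \<bullet> \<gamma> 0)) (at 0)"
    using assms(1) unfolding has_vector_derivative_def by (intro has_derivative_inner)
  moreover have "((\<lambda>t. \<gamma> t \<bullet> \<gamma> t) has_derivative (\<lambda>t. 0)) (at 0)"
    by (rule has_derivative_transform_within_open[of "\<lambda>_. c" _ _ _ "{-\<epsilon><..<\<epsilon>}"])
       (use assms(2,3) in auto)
  ultimately have "(\<lambda>t. \<gamma> 0 \<bullet> (t *\<^sub>R v) + (t *\<^sub>R v) \<bullet> \<gamma> 0) = (\<lambda>t::real. 0)"
    by (rule has_derivative_unique)
  from fun_cong[OF this, of 1] show ?thesis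
    by (simp add: inner_commute)
qed

locale parametrized_hypersurface =
  fixes M :: "'a::euclidean_space set" and \<nu> :: "'a \<Rightarrow> 'a"
    and U :: "(real^'n::finite) set" and \<phi> :: "real^'n \<Rightarrow> 'a"
  assumes hypersurface: "sphere_hypersurface TYPE('n) M"
    and normal: "unit_normal_field TYPE('n) M \<nu>"
    and param: "local_parametrization M U \<phi>"
begin

lemma open_domain: "open U"
  and smooth_param: "smooth_map U \<phi>"
  and inj_param: "u \<in> U \<Longrightarrow> inj (\<lambda>w. \<partial>\<^bsub>w\<^esub> \<phi> u)"
  and openin_image: "openin (top_of_set M) (\<phi> ` U)"
  using param by (simp_all add: local_parametrization_def smooth_on_eq_smooth_map dir_deriv_def)

lemma image_subset: "\<phi> ` U \<subseteq> M"
  using openin_imp_subset[OF openin_image] .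

lemma in_M: "u \<in> U \<Longrightarrow> \<phi> u \<in> M"
  using image_subset by blast

lemma in_sphere: "p \<in> M \<Longrightarrow> p \<bullet> p = 1"
  using hypersurface by (auto simp: sphere_hypersurface_def dot_square_norm)

lemma normal_facts:
  assumes "p \<in> M"
  shows "\<nu> p \<bullet> \<nu> p = 1" "\<nu> p \<bullet> p = 0" "v \<in> tangent_space M p \<Longrightarrow> \<nu> p \<bullet> v = 0"
  using normal assms by (auto simp: unit_normal_field_def dot_square_norm)

lemma smooth_normal: "smooth_map U (\<nu> \<circ> \<phi>)"
  using normal param by (auto simp: unit_normal_field_def smooth_on_eq_smooth_map)

lemma d\<phi>_in_tangent_space:
  assumes "u \<in> U"
  shows "\<partial>\<^bsub>w\<^esub> \<phi> u \<in> tangent_space M (\<phi> u)"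
proof -
  define \<gamma> where "\<gamma> t = \<phi> (u + t *\<^sub>R w)" for t :: real
  have "open ((\<lambda>t::real. u + t *\<^sub>R w) -` U)"
    by (intro open_vimage open_domain continuous_intros)
  then obtain \<epsilon> where \<epsilon>: "\<epsilon> > 0" "ball 0 \<epsilon> \<subseteq> (\<lambda>t::real. u + t *\<^sub>R w) -` U"
    using assms unfolding open_contains_ball by force
  have "{-\<epsilon><..<\<epsilon>} = ball 0 \<epsilon>"
    by (auto simp: dist_real_def)
  then have "\<gamma> ` {-\<epsilon><..<\<epsilon>} \<subseteq> M"
    using \<epsilon>(2) in_M unfolding \<gamma>_def by auto
  moreover have "(\<gamma> has_vector_derivative \<partial>\<^bsub>w\<^esub> \<phi> u) (at 0)"
  proof -
    have der: "(\<phi> has_derivative (\<lambda>w. \<partial>\<^bsub>w\<^esub> \<phi> u)) (at (u + 0 *\<^sub>R w))"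
      using smooth_map_has_derivative[OF smooth_param assms] by simp
    have line: "((\<lambda>t::real. u + t *\<^sub>R w) has_derivative (\<lambda>t. t *\<^sub>R w)) (at 0)"
      by (auto intro!: derivative_eq_intros)
    have "(\<gamma> has_derivative (\<lambda>t. \<partial>\<^bsub>t *\<^sub>R w\<^esub> \<phi> u)) (at 0)"
      unfolding \<gamma>_def by (rule has_derivative_compose[OF line der])
    moreover have "(\<lambda>t. \<partial>\<^bsub>t *\<^sub>R w\<^esub> \<phi> u) = (\<lambda>t. t *\<^sub>R \<partial>\<^bsub>w\<^esub> \<phi> u)"
      using linear_cmul[OF linear_dir_deriv[OF smooth_map_differentiable[OF smooth_param assms]]]
      by simp
    ultimately show ?thesis
      by (simp add: has_vector_derivative_def)
  qed
  moreover have "\<gamma> 0 = \<phi> u" by (simp add: \<gamma>_def)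
  ultimately show ?thesis
    using \<epsilon>(1) unfolding tangent_space_def by blast
qed

sublocale sphere_patch U \<phi> "\<nu> \<circ> \<phi>"
proof
  show "DIM('a) = CARD('n) + 2"
    using hypersurface by (simp add: sphere_hypersurface_def)
qed (simp_all add: open_domain smooth_param smooth_normal inj_param in_M in_sphere normal_facts
      d\<phi>_in_tangent_space)

text \<open>
  A velocity of a curve in \<open>M\<close> is orthogonal to the position vector and to the normal, and these
  two conditions characterize the image of the derivative of \<open>\<phi>\<close>.
\<close>
lemma tangent_space_eq:
  assumes "u \<in> U"
  shows "tangent_space M (\<phi> u) = range (\<lambda>w. \<partial>\<^bsub>w\<^esub> \<phi> u)"
proof (intro equalityI subsetI)
  fix v assume v: "v \<in> tangent_space M (\<phi> u)"
  then obtain \<gamma> \<epsilon> where \<gamma>: "\<epsilon> > 0" "\<gamma> ` {-\<epsilon><..<\<epsilon>} \<subseteq> M" "\<gamma> 0 = \<phi> u"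
    "(\<gamma> has_vector_derivative v) (at 0)"
    unfolding tangent_space_def by blast
  have "\<gamma> 0 \<bullet> v = 0"
    by (rule inner_vector_derivative_zero[OF \<gamma>(4,1)]) (use \<gamma>(2) in_sphere in blast)
  then have "v \<bullet> \<phi> u = 0" using \<gamma>(3) by (simp add: inner_commute)
  moreover have "v \<bullet> \<nu> (\<phi> u) = 0"
    using normal_facts(3)[OF in_M[OF assms] v] by (simp add: inner_commute)
  ultimately show "v \<in> range (\<lambda>w. \<partial>\<^bsub>w\<^esub> \<phi> u)"
    unfolding range_d\<phi>[OF assms] by simp
qed (use d\<phi>_in_tangent_space[OF assms] in blast)

text \<open>
  In particular \<open>\<nu>\<close> is differentiable within \<open>M\<close>, so that the Frechet derivative in the shape
  operator, which is an arbitrary choice among the derivatives within \<open>M\<close>, is one of them.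
\<close>
lemma normal_has_derivative:
  assumes "u \<in> U"
  shows "(\<nu> has_derivative (\<lambda>v. - T u v)) (at (\<phi> u) within M)"
proof -
  obtain \<psi> where "homeomorphism U (\<phi> ` U) \<phi> \<psi>"
    using param unfolding local_parametrization_def by blast
  then have \<psi>: "continuous_on (\<phi> ` U) \<psi>" "\<And>w. w \<in> U \<Longrightarrow> \<psi> (\<phi> w) = w"
    by (auto simp: homeomorphism_def)
  have "(\<nu> has_derivative (\<lambda>v. - T u v)) (at (\<phi> u) within \<phi> ` U)"
  proof (rule has_derivative_within_immersed_image[OF assms \<psi>])
    show "(\<phi> has_derivative (\<lambda>w. \<partial>\<^bsub>w\<^esub> \<phi> u)) (at u)"
      by (rule smooth_map_has_derivative[OF smooth_param assms])
    show "inj (\<lambda>w. \<partial>\<^bsub>w\<^esub> \<phi> u)" by (rule inj_param[OF assms])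
    show "((\<lambda>w. \<nu> (\<phi> w)) has_derivative (\<lambda>w. \<partial>\<^bsub>w\<^esub> (\<nu> \<circ> \<phi>) u)) (at u)"
      using smooth_map_has_derivative[OF smooth_normal assms] by (simp add: o_def)
    show "bounded_linear (\<lambda>v. - T u v)"
      by (intro bounded_linear_minus blinfun.bounded_linear_right)
    show "- T u (\<partial>\<^bsub>w\<^esub> \<phi> u) = \<partial>\<^bsub>w\<^esub> (\<nu> \<circ> \<phi>) u" for w
      by (simp add: T_d\<phi>[OF assms])
  qed
  moreover obtain V where V: "open V" "\<phi> ` U = M \<inter> V"
    using openin_image by (auto simp: openin_open)
  then have "at (\<phi> u) within \<phi> ` U = at (\<phi> u) within M"
    using assms by (intro at_within_nhd[of _ V]) auto
  ultimately show ?thesis by simp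
qed

lemma shape_operator_eq:
  assumes "u \<in> U" "v \<in> tangent_space M (\<phi> u)"
  shows "shape_operator M \<nu> (\<phi> u) v = T u v"
proof -
  obtain w where w: "v = \<partial>\<^bsub>w\<^esub> \<phi> u"
    using assms tangent_space_eq by auto
  define D where "D = frechet_derivative \<nu> (at (\<phi> u) within M)"
  have "\<nu> differentiable at (\<phi> u) within M"
    using normal_has_derivative[OF assms(1)] by (rule differentiableI)
  then have "(\<nu> has_derivative D) (at (\<phi> u) within M)"
    unfolding D_def frechet_derivative_works .
  then have "(\<nu> has_derivative D) (at (\<phi> u) within \<phi> ` U)"
    by (rule has_derivative_subset[OF _ image_subset])
  moreover have "(\<phi> has_derivative (\<lambda>w. \<partial>\<^bsub>w\<^esub> \<phi> u)) (at u within U)"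
    by (rule has_derivative_at_withinI[OF smooth_map_has_derivative[OF smooth_param assms(1)]])
  ultimately have "(\<nu> \<circ> \<phi> has_derivative D \<circ> (\<lambda>w. \<partial>\<^bsub>w\<^esub> \<phi> u)) (at u within U)"
    by (intro diff_chain_within)
  then have "(\<nu> \<circ> \<phi> has_derivative D \<circ> (\<lambda>w. \<partial>\<^bsub>w\<^esub> \<phi> u)) (at u)"
    by (simp add: at_within_open[OF assms(1) open_domain])
  from dir_deriv_eqI[OF this, of w] have "D v = - T u v"
    by (simp add: w T_d\<phi>[OF assms(1)])
  then show ?thesis
    by (simp add: shape_operator_def D_def)
qed

lemma shape_eigenspace_eq:
  assumes "u \<in> U"
  shows "shape_eigenspace M \<nu> (\<phi> u) \<kappa> = {v \<in> range (\<lambda>w. \<partial>\<^bsub>w\<^esub> \<phi> u). T u v = \<kappa> *\<^sub>R v}"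
  using shape_operator_eq[OF assms] tangent_space_eq[OF assms]
  by (auto simp: shape_eigenspace_def)

text \<open>
  The functions \<open>principal_curvature M \<nu> i\<close> with \<open>i < n\<close> exhaust the eigenvalues because the
  dimensions of the eigenspaces add up to at most \<open>n\<close>.
\<close>
lemma eigenvalue_is_principal_curvature:
  assumes u: "u \<in> U" and v: "v \<in> range (\<lambda>w. \<partial>\<^bsub>w\<^esub> \<phi> u)" "v \<noteq> 0" "T u v = \<kappa> *\<^sub>R v"
  obtains i where "i < CARD('n)" "\<kappa> = principal_curvature M \<nu> i (\<phi> u)"
proof -
  let ?W = "range (\<lambda>w. \<partial>\<^bsub>w\<^esub> \<phi> u)"
  define K where "K = {\<kappa>. \<exists>v\<in>shape_eigenspace M \<nu> (\<phi> u) \<kappa>. v \<noteq> 0}"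
  define P where "P = principal_curvatures M \<nu> (\<phi> u)"
  have P: "P = (\<Sum>\<kappa>\<in>K. replicate_mset (dim (shape_eigenspace M \<nu> (\<phi> u) \<kappa>)) \<kappa>)"
    by (simp add: P_def K_def principal_curvatures_def)
  have lin: "linear (T u)"
    by (rule bounded_linear.linear[OF blinfun.bounded_linear_right])
  have sub: "subspace ?W"
    by (rule linear_subspace_image[OF linear_d\<phi>[OF u] subspace_UNIV])
  have dimW: "dim ?W = CARD('n)"
    using dim_image_eq[OF linear_d\<phi>[OF u], of UNIV] immersion[OF u] by simp
  have "finite K"
    unfolding K_def shape_eigenspace_eq[OF u]
    by (rule finite_eigenvalues[OF lin sub T_self_adjoint[OF u]])
  have "size P = (\<Sum>\<kappa>\<in>K. dim (shape_eigenspace M \<nu> (\<phi> u) \<kappa>))"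
    by (simp add: P)
  also have "\<dots> \<le> CARD('n)"
    unfolding shape_eigenspace_eq[OF u] dimW[symmetric]
    by (rule sum_dim_eigenspaces_le[OF lin sub \<open>finite K\<close> T_self_adjoint[OF u]])
  finally have size: "size P \<le> CARD('n)" .
  have mem: "v \<in> shape_eigenspace M \<nu> (\<phi> u) \<kappa>"
    unfolding shape_eigenspace_eq[OF u] using v by simp
  then have "\<kappa> \<in> K"
    using v(2) by (auto simp: K_def)
  have "\<not> shape_eigenspace M \<nu> (\<phi> u) \<kappa> \<subseteq> {0}"
    using mem v(2) by auto
  then have "dim (shape_eigenspace M \<nu> (\<phi> u) \<kappa>) \<noteq> 0"
    unfolding dim_eq_0 .
  then have "\<kappa> \<in># P"
    unfolding P using \<open>finite K\<close> \<open>\<kappa> \<in> K\<close>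
    by (subst sum.remove[of K \<kappa>]) auto
  then have "\<kappa> \<in> set (sorted_list_of_multiset P)" by simp
  then obtain i where "i < length (sorted_list_of_multiset P)" "sorted_list_of_multiset P ! i = \<kappa>"
    unfolding in_set_conv_nth by blast
  moreover have "length (sorted_list_of_multiset P) = size P"
    by (metis mset_sorted_list_of_multiset size_mset)
  ultimately show ?thesis
    using that[of i] size by (simp add: principal_curvature_def P_def)
qed

end

section \<open>Nonnegativity of the scalar curvature\<close>

theorem proposition1p1:
  fixes M :: "'a::euclidean_space set"
  assumes "isoparametric_hypersurface TYPE('n::finite) M"
  shows "\<forall>p\<in>M. \<forall>U (\<phi> :: real^'n \<Rightarrow> 'a). \<forall>u\<in>U.
           local_parametrization M U \<phi> \<and> \<phi> u = p \<longrightarrow> 0 \<le> scalar_curvature (induced_metric \<phi>) u"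
proof (intro ballI allI impI, elim conjE)
  fix p U u and \<phi> :: "real^'n \<Rightarrow> 'a"
  assume "p \<in> M" and u: "u \<in> U" and param: "local_parametrization M U \<phi>"
  obtain \<nu> where hyp: "sphere_hypersurface TYPE('n) M" and \<nu>: "unit_normal_field TYPE('n) M \<nu>"
    and const: "\<And>i. i < CARD('n) \<Longrightarrow> principal_curvature M \<nu> i constant_on M"
    using assms unfolding isoparametric_hypersurface_def by blast
  interpret parametrized_hypersurface M \<nu> U \<phi>
    by unfold_locales (fact hyp \<nu> param)+
  \<comment> \<open>The extended operator has the eigenvalue \<open>0\<close> on the normal plane in any case.\<close>
  define \<Lambda> where "\<Lambda> = insert 0 ((\<lambda>i. principal_curvature M \<nu> i p) ` {..<CARD('n)})"
  let ?W = "range (\<lambda>w. \<partial>\<^bsub>w\<^esub> \<phi> u)"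
  have "linear (T u)"
    by (rule bounded_linear.linear[OF blinfun.bounded_linear_right])
  moreover have "subspace ?W"
    by (rule linear_subspace_image[OF linear_d\<phi>[OF u] subspace_UNIV])
  moreover have "T u ` ?W \<subseteq> ?W"
    unfolding range_d\<phi>[OF u] using T_tangent[OF u] by blast
  ultimately obtain B where B: "finite B" "span B = ?W" "pairwise orthogonal B"
    "\<forall>b\<in>B. norm b = 1 \<and> (\<exists>c. T u b = c *\<^sub>R b)"
    using self_adjoint_eigenbasis[of "T u" ?W] T_self_adjoint[OF u] by auto
  interpret isoparametric_patch U \<phi> "\<nu> \<circ> \<phi>" \<Lambda> u B "\<lambda>b. T u b \<bullet> b"
  proof
    show "u \<in> U" "finite B" "pairwise orthogonal B" "span B = ?W" by fact+
    show "finite \<Lambda>" by (simp add: \<Lambda>_def)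
    show "norm b = 1" if "b \<in> B" for b
      using bspec[OF B(4) that] by simp
    show "T u b = (T u b \<bullet> b) *\<^sub>R b" if bB: "b \<in> B" for b
    proof -
      obtain c where c: "norm b = 1" "T u b = c *\<^sub>R b"
        using bspec[OF B(4) bB] by (elim conjE exE)
      then have "T u b \<bullet> b = c" by (simp add: dot_square_norm)
      then show ?thesis using c(2) by simp
    qed
    show "\<mu> \<in> \<Lambda>" if y: "y \<in> U" and v: "v \<noteq> 0" "T y v = \<mu> *\<^sub>R v" for y v \<mu>
    proof (cases "\<mu> = 0")
      case False
      have "\<mu> * (v \<bullet> \<phi> y) = 0" "\<mu> * (v \<bullet> \<nu> (\<phi> y)) = 0"
        using T_tangent[OF y, of v] v(2) by simp_all
      then have tangent: "v \<in> range (\<lambda>w. \<partial>\<^bsub>w\<^esub> \<phi> y)"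
        unfolding range_d\<phi>[OF y] using False by simp
      obtain i where i: "i < CARD('n)" "\<mu> = principal_curvature M \<nu> i (\<phi> y)"
        by (rule eigenvalue_is_principal_curvature[OF y tangent v])
      have "principal_curvature M \<nu> i (\<phi> y) = principal_curvature M \<nu> i p"
        using const[OF i(1)] in_M[OF y] \<open>p \<in> M\<close> unfolding constant_on_def by metis
      then show ?thesis using i by (simp add: \<Lambda>_def)
    qed (simp add: \<Lambda>_def)
  qed
  show "0 \<le> scalar_curvature (induced_metric \<phi>) u"
    by (rule scalar_curvature_nonneg)
qed

end
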